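(* For every real $\rho \geq 1$ and every graph $H$ with at least one edge, $$RT(n,H,\rho\text{-mean}) \leq RT(n,K_{\chi(H)},\rho\text{-mean})+o(n^2)$$ as $n\to\infty$ (with $H$ and $\rho$ fixed). In particular, if the chromatic number $\chi(H)$ of $H$ equals the clique number of $H$, then $$RT(n,H,\rho\text{-mean}) = RT(n,K_{\chi(H)},\rho\text{-mean})+o(n^2).$$
   Context: All graphs are finite, undirected and simple. An edge coloring is an arbitrary assignment of colors to the edges (not necessarily proper, with no a priori bound on the total number of colors). A color is incident with a vertex $v$ if some edge containing $v$ has that color; an isolated vertex is incident with $0$ colors. For a real $\rho\ge 1$, an edge coloring of a graph with $n$ vertices is called $\rho$-mean if the average, over all $n$ vertices, of the number of distinct colors incident with the vertex is at most $\rho$. A monochromatic copy of $H$ is a (not necessarily induced) subgraph isomorphic to $H$ all of whose edges have the same color. $RT(n,H,\rho\text{-mean})$ is the maximum number of edges of a graph with $n$ vertices that admits a $\rho$-mean edge coloring with no monochromatic copy of $H$. *)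

theory Defs
  imports Complex_Main "HOL-Library.Landau_Symbols"
begin

record 'a sgraph =
  verts :: "'a set"
  edges :: "'a set set"

definition simple_graph :: "'a sgraph \<Rightarrow> bool" where
  "simple_graph G \<longleftrightarrow> finite (verts G) \<and> (\<forall>e\<in>edges G. e \<subseteq> verts G \<and> card e = 2)"

definition subgraph :: "'a sgraph \<Rightarrow> 'a sgraph \<Rightarrow> bool" where
  "subgraph S G \<longleftrightarrow> simple_graph S \<and> verts S \<subseteq> verts G \<and> edges S \<subseteq> edges G"

definition graph_iso :: "'a sgraph \<Rightarrow> 'b sgraph \<Rightarrow> bool" where
  "graph_iso G H \<longleftrightarrow>
     (\<exists>f. bij_betw f (verts G) (verts H) \<and> edges H = (\<lambda>e. f ` e) ` edges G)"

definition complete_graph :: "nat \<Rightarrow> nat sgraph" where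
  "complete_graph k = \<lparr>verts = {..<k}, edges = {e. e \<subseteq> {..<k} \<and> card e = 2}\<rparr>"

definition proper_vertex_coloring :: "'a sgraph \<Rightarrow> nat \<Rightarrow> ('a \<Rightarrow> nat) \<Rightarrow> bool" where
  "proper_vertex_coloring G k c \<longleftrightarrow> (\<forall>v\<in>verts G. c v < k) \<and>
     (\<forall>u\<in>verts G. \<forall>v\<in>verts G. {u, v} \<in> edges G \<longrightarrow> c u \<noteq> c v)"

definition chromatic_number :: "'a sgraph \<Rightarrow> nat" where
  "chromatic_number G = (LEAST k. \<exists>c. proper_vertex_coloring G k c)"

definition is_clique :: "'a sgraph \<Rightarrow> 'a set \<Rightarrow> bool" where
  "is_clique G K \<longleftrightarrow> K \<subseteq> verts G \<and> (\<forall>u\<in>K. \<forall>v\<in>K. u \<noteq> v \<longrightarrow> {u, v} \<in> edges G)"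

definition clique_number :: "'a sgraph \<Rightarrow> nat" where
  "clique_number G = Max (card ` {K. is_clique G K})"

text \<open>
  An edge coloring of \<open>G\<close> is a function on sets of vertices of which only the values on
  \<open>edges G\<close> matter. Colors are natural numbers: a finite graph uses finitely many colors, so
  this puts no bound on their number.
\<close>

definition incident_colors :: "'a sgraph \<Rightarrow> ('a set \<Rightarrow> nat) \<Rightarrow> 'a \<Rightarrow> nat set" where
  "incident_colors G c v = c ` {e \<in> edges G. v \<in> e}"

definition mean_coloring :: "real \<Rightarrow> 'a sgraph \<Rightarrow> ('a set \<Rightarrow> nat) \<Rightarrow> bool" where
  "mean_coloring \<rho> G c \<longleftrightarrow>
     (\<Sum>v\<in>verts G. real (card (incident_colors G c v))) / real (card (verts G)) \<le> \<rho>"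

definition has_monochromatic_copy :: "'b sgraph \<Rightarrow> 'a sgraph \<Rightarrow> ('a set \<Rightarrow> nat) \<Rightarrow> bool" where
  "has_monochromatic_copy H G c \<longleftrightarrow>
     (\<exists>S. subgraph S G \<and> graph_iso S H \<and> (\<exists>k. \<forall>e\<in>edges S. c e = k))"

text \<open>
  Every finite graph is isomorphic to one whose vertices are natural numbers, so the host graph
  may be taken of this form.
\<close>

definition RT_edge_counts :: "nat \<Rightarrow> 'b sgraph \<Rightarrow> real \<Rightarrow> nat set" where
  "RT_edge_counts n H \<rho> = {card (edges G) | G :: nat sgraph.
     simple_graph G \<and> card (verts G) = n \<and>
     (\<exists>c. mean_coloring \<rho> G c \<and> \<not> has_monochromatic_copy H G c)}"

definition RT :: "nat \<Rightarrow> 'b sgraph \<Rightarrow> real \<Rightarrow> nat" where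
  "RT n H \<rho> = Max (RT_edge_counts n H \<rho>)"

text \<open>The maximum in \<^const>\<open>RT\<close> is over a finite nonempty set.\<close>

lemma finite_RT_edge_counts: "finite (RT_edge_counts n H \<rho>)"
proof -
  have "card (edges G) \<le> 2 ^ n"
    if "simple_graph G" "card (verts G) = n" for G :: "nat sgraph"
  proof -
    have "edges G \<subseteq> Pow (verts G)" "finite (verts G)"
      using that by (auto simp: simple_graph_def)
    then show ?thesis
      using card_mono[of "Pow (verts G)" "edges G"] that(2) by (simp add: card_Pow)
  qed
  then have "RT_edge_counts n H \<rho> \<subseteq> {..2 ^ n}"
    unfolding RT_edge_counts_def by auto
  then show ?thesis
    by (rule finite_subset) simp
qed

lemma RT_edge_counts_nonempty:
  assumes "edges H \<noteq> {}" "\<rho> \<ge> 0"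
  shows "RT_edge_counts n H \<rho> \<noteq> {}"
proof -
  let ?G = "\<lparr>verts = {..<n}, edges = {}\<rparr> :: nat sgraph"
  have "simple_graph ?G" "card (verts ?G) = n" "mean_coloring \<rho> ?G (\<lambda>_. 0)"
    using assms(2) by (simp_all add: simple_graph_def mean_coloring_def incident_colors_def)
  moreover have "\<not> has_monochromatic_copy H ?G (\<lambda>_. 0)"
    using assms(1) by (auto simp: has_monochromatic_copy_def subgraph_def graph_iso_def)
  ultimately show ?thesis
    unfolding RT_edge_counts_def by blast
qed

end

theory Submission
  imports Defs "HOL-Library.FuncSet"
begin

text \<open>
  Let \<open>r = \<chi>(H)\<close>. The upper bound is a supersaturation argument, with random sampling taking the
  place of the regularity and removal lemmas.

  \<^item> If \<open>G\<close> has \<open>n\<close> vertices, a \<open>\<rho>\<close>-mean coloring and more than \<open>RT(n, K\<^sub>r) + \<epsilon>n\<^sup>2\<close> edges, then a positive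
    proportion of all \<open>r\<close>-tuples of vertices are monochromatic \<open>r\<close>-cliques (\<open>clique_supersaturation\<close>).
    Indeed, let a random map from a set of constant size \<open>s\<close> into the vertices pull \<open>G\<close> and its coloring
    back to \<open>s\<close> vertices. On average the sample has about the edge density of \<open>G\<close>. Its mean number
    of colors is, outside an event of small probability, at most slightly more than \<open>\<rho>\<close>, by Chebyshev's
    inequality; this needs bounded numbers of colors, so the few vertices with very many colors are first
    isolated. A sample without monochromatic \<open>K\<^sub>r\<close> and with such a mean can be blown up to at most \<open>n\<close>
    vertices and padded with isolated vertices, which repairs the mean, so its density is at most
    about that of \<open>RT(n, K\<^sub>r)\<close> (\<open>clique_free_density_le_RT\<close>). As \<open>G\<close> is denser than this by \<open>\<epsilon>\<close>, a positive
    proportion of the samples contains a monochromatic \<open>K\<^sub>r\<close>.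

  \<^item> A \<open>\<rho>\<close>-mean coloring has at most \<open>\<rho>n\<close> incidences of colors with vertices, so a single color already
    carries a positive proportion of all \<open>r\<close>-tuples (\<open>popular_color\<close>).

  \<^item> By Erdos' theorem on complete \<open>r\<close>-partite hypergraphs (\<open>dense_tuples_contain_box\<close>), a positive
    proportion of the \<open>r\<close>-tuples contains a box \<open>A\<^sub>1 \<times> \<dots> \<times> A\<^sub>r\<close> with sides of any prescribed constant
    size. This is a monochromatic complete \<open>r\<close>-partite graph, and the \<open>r\<close>-colorable graph \<open>H\<close> embeds in it.

  Hence a coloring without monochromatic \<open>H\<close> forces at most \<open>RT(n, K\<^sub>r) + \<epsilon>n\<^sup>2\<close> edges for large \<open>n\<close>. If \<open>H\<close>
  contains \<open>K\<^sub>r\<close>, every monochromatic \<open>H\<close> contains a monochromatic \<open>K\<^sub>r\<close>, which gives the reverse inequality.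
\<close>

section \<open>Complete multipartite boxes in dense sets of tuples\<close>

text \<open>
  Erdos' theorem on \<open>r\<close>-partite \<open>r\<close>-uniform hypergraphs, stated for sets of lists. Induction on \<open>r\<close>: a
  positive proportion of the tails \<open>w\<close> are rich, that is, extend by at least \<open>cn/2\<close> first entries, and each
  rich tail sees a positive proportion of all \<open>t\<close>-sets of first entries. So some \<open>t\<close>-set \<open>X\<close> is seen by a
  positive proportion of all tails, to which the induction hypothesis applies.
\<close>

lemma dense_tuples_contain_box:
  fixes c :: real and t r :: nat
  assumes "c > 0" and "t \<ge> 1"
  shows "\<exists>N. \<forall>(V :: 'a set) T. finite V \<longrightarrow> card V \<ge> N \<longrightarrow>
           T \<subseteq> {xs. set xs \<subseteq> V \<and> length xs = r} \<longrightarrow> real (card T) \<ge> c * real (card V) ^ r \<longrightarrow>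
           (\<exists>As. length As = r \<and> (\<forall>A\<in>set As. A \<subseteq> V \<and> card A = t) \<and> listset As \<subseteq> T)"
  using assms(1)
proof (induction r arbitrary: c)
  case 0
  have "listset [] \<subseteq> T" if "T \<subseteq> {xs. set xs \<subseteq> V \<and> length xs = 0}" "real (card T) \<ge> c"
    for V and T :: "'a list set"
  proof -
    have "T \<noteq> {}"
      using that(2) \<open>c > 0\<close> by auto
    then show ?thesis
      using that(1) by auto
  qed
  then show ?case
    by (intro exI[of _ 0]) (auto intro!: exI[of _ "[]"])
next
  case (Suc r)
  \<comment> \<open>The proportion of rich tails times the proportion of \<open>t\<close>-sets that each of them sees.\<close>
  define c' where "c' = c / 2 * (c / (2 * real t)) ^ t"
  have "c' > 0"
    using Suc.prems assms(2) by (simp add: c'_def)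
  from Suc.IH[OF this] obtain N where N: "\<And>(V :: 'a set) T. finite V \<Longrightarrow> card V \<ge> N \<Longrightarrow>
      T \<subseteq> {xs. set xs \<subseteq> V \<and> length xs = r} \<Longrightarrow> real (card T) \<ge> c' * real (card V) ^ r \<Longrightarrow>
      \<exists>As. length As = r \<and> (\<forall>A\<in>set As. A \<subseteq> V \<and> card A = t) \<and> listset As \<subseteq> T"
    by blast
  have "\<exists>As. length As = Suc r \<and> (\<forall>A\<in>set As. A \<subseteq> V \<and> card A = t) \<and> listset As \<subseteq> T"
    if V: "finite V" "card V \<ge> max N (nat \<lceil>2 * real t / c\<rceil>)"
      and T: "T \<subseteq> {xs. set xs \<subseteq> V \<and> length xs = Suc r}"
      and dense: "real (card T) \<ge> c * real (card V) ^ Suc r"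
    for V :: "'a set" and T
  proof -
    define n where "n = card V"
    define W where "W = {xs. set xs \<subseteq> V \<and> length xs = r}"
    define nb where "nb w = {x\<in>V. x # w \<in> T}" for w
    define rich where "rich = {w\<in>W. real (card (nb w)) \<ge> c * n / 2}"
    define Xs where "Xs = {X. X \<subseteq> V \<and> card X = t}"
    \<comment> \<open>This size makes every rich neighbourhood large enough to contain \<open>t\<close>-sets at all.\<close>
    have n_large: "c * n / 2 \<ge> t"
    proof -
      have "real n \<ge> 2 * real t / c"
        using V(2) by (simp add: n_def)
      then show ?thesis
        using Suc.prems by (simp add: field_simps)
    qed
    then have "n > 0"
      using assms(2) by (cases n) auto
    have finW: "finite W" and cardW: "card W = n ^ r"
      using V(1) by (auto simp: W_def n_def finite_lists_length_eq card_lists_length_eq)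
    have nb_sub: "nb w \<subseteq> V" and fin_nb: "finite (nb w)" for w
      using V(1) by (auto simp: nb_def)
    have fin_rich: "finite rich" and rich_sub: "rich \<subseteq> W"
      using finW by (auto simp: rich_def)
    have finXs: "finite Xs"
      using V(1) by (auto simp: Xs_def)
    have cardXs: "real (card Xs) \<le> real n ^ t"
    proof -
      have "card Xs = n choose t"
        using n_subsets[OF V(1)] by (simp add: Xs_def n_def)
      also have "\<dots> \<le> n ^ t"
        by (cases "t \<le> n") (auto intro: binomial_le_pow simp: binomial_eq_0)
      finally show ?thesis
        by (metis of_nat_le_iff of_nat_power)
    qed
    have "T = (\<lambda>(w, x). x # w) ` (SIGMA w:W. nb w)"
    proof (intro equalityI subsetI)
      fix xs assume "xs \<in> T"
      then have "set xs \<subseteq> V" "length xs = Suc r"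
        using T by auto
      then obtain x w where "xs = x # w"
        by (cases xs) auto
      then have "(w, x) \<in> (SIGMA w:W. nb w)"
        using \<open>xs \<in> T\<close> \<open>set xs \<subseteq> V\<close> \<open>length xs = Suc r\<close> by (auto simp: W_def nb_def)
      then show "xs \<in> (\<lambda>(w, x). x # w) ` (SIGMA w:W. nb w)"
        using \<open>xs = x # w\<close> by force
    qed (auto simp: nb_def)
    moreover have "inj_on (\<lambda>(w, x). x # w) (SIGMA w:W. nb w)"
      by (auto simp: inj_on_def)
    ultimately have "card T = card (SIGMA w:W. nb w)"
      by (simp add: card_image)
    also have "\<dots> = (\<Sum>w\<in>W. card (nb w))"
      using finW fin_nb by simp
    finally have "real (card T) = (\<Sum>w\<in>W. real (card (nb w)))"
      by simp
    also have "\<dots> \<le> (\<Sum>w\<in>W. of_bool (w \<in> rich) * real n + c * n / 2)"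
    proof (rule sum_mono)
      fix w assume "w \<in> W"
      have "card (nb w) \<le> n"
        using nb_sub V(1) by (auto simp: n_def intro: card_mono)
      then show "real (card (nb w)) \<le> of_bool (w \<in> rich) * real n + c * n / 2"
        using \<open>w \<in> W\<close> Suc.prems by (auto simp: rich_def add_increasing2)
    qed
    also have "\<dots> = real (card rich) * n + real n ^ r * (c * n / 2)"
    proof -
      have "W \<inter> rich = rich"
        using rich_sub by auto
      then show ?thesis
        using finW by (simp add: sum.distrib sum_distrib_right[symmetric] cardW Int_def)
    qed
    finally have "c / 2 * real n ^ r * n \<le> real (card rich) * n"
      using dense by (simp add: n_def[symmetric] algebra_simps)
    then have rich_many: "c / 2 * real n ^ r \<le> real (card rich)"
      using \<open>n > 0\<close> by simp
    have rich_subsets: "(c / (2 * t)) ^ t * real n ^ t \<le> real (card {X\<in>Xs. X \<subseteq> nb w})"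
      if "w \<in> rich" for w
    proof -
      have big: "real (card (nb w)) \<ge> c * n / 2"
        using that by (simp add: rich_def)
      then have "t \<le> card (nb w)"
        using n_large by linarith
      have "(c / (2 * t)) ^ t * real n ^ t = (c * n / 2 / t) ^ t"
        by (simp add: power_mult_distrib[symmetric])
      also have "\<dots> \<le> (real (card (nb w)) / t) ^ t"
        using big Suc.prems by (intro power_mono divide_right_mono) auto
      also have "\<dots> \<le> real (card (nb w) choose t)"
        using binomial_ge_n_over_k_pow_k[OF \<open>t \<le> card (nb w)\<close>, where 'a = real] by simp
      also have "card (nb w) choose t = card {X. X \<subseteq> nb w \<and> card X = t}"
        using n_subsets[OF fin_nb] by simp
      also have "{X. X \<subseteq> nb w \<and> card X = t} = {X\<in>Xs. X \<subseteq> nb w}"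
        using nb_sub by (auto simp: Xs_def)
      finally show ?thesis .
    qed
    \<comment> \<open>Double counting of the pairs of a rich \<open>w\<close> and a \<open>t\<close>-set inside \<open>nb w\<close>.\<close>
    have "c' * real n ^ r * real n ^ t \<le> real (card rich) * ((c / (2 * t)) ^ t * real n ^ t)"
      using mult_right_mono[OF rich_many, of "(c / (2 * t)) ^ t * real n ^ t"] Suc.prems
      by (simp add: c'_def mult_ac)
    also have "\<dots> = (\<Sum>w\<in>rich. (c / (2 * t)) ^ t * real n ^ t)"
      by simp
    also have "\<dots> \<le> (\<Sum>w\<in>rich. real (card {X\<in>Xs. X \<subseteq> nb w}))"
      by (intro sum_mono rich_subsets)
    also have "\<dots> = real (\<Sum>X\<in>Xs. card {w\<in>rich. X \<subseteq> nb w})"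
      by (subst sum_multicount_gen[of Xs rich "\<lambda>X w. X \<subseteq> nb w" "\<lambda>w. card {X\<in>Xs. X \<subseteq> nb w}"])
         (auto simp: finXs fin_rich)
    finally have total: "c' * real n ^ r * real n ^ t \<le> (\<Sum>X\<in>Xs. real (card {w\<in>rich. X \<subseteq> nb w}))"
      by simp
    obtain X where X: "X \<in> Xs" "c' * real n ^ r \<le> real (card {w\<in>rich. X \<subseteq> nb w})"
    proof -
      have pos: "c' * real n ^ r * real n ^ t > 0"
        using \<open>c' > 0\<close> \<open>n > 0\<close> by simp
      have "\<exists>X\<in>Xs. c' * real n ^ r \<le> real (card {w\<in>rich. X \<subseteq> nb w})"
      proof (rule ccontr)
        assume none: "\<not> ?thesis"
        have "Xs \<noteq> {}"
          using total pos by auto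
        then have "(\<Sum>X\<in>Xs. real (card {w\<in>rich. X \<subseteq> nb w})) < (\<Sum>X\<in>Xs. c' * real n ^ r)"
          using none finXs by (intro sum_strict_mono) (auto simp: not_le)
        also have "\<dots> \<le> real n ^ t * (c' * real n ^ r)"
          using cardXs \<open>c' > 0\<close> by (simp add: mult_right_mono)
        finally show False
          using total by (simp add: mult_ac)
      qed
      then show ?thesis
        using that by blast
    qed
    have "{w\<in>rich. X \<subseteq> nb w} \<subseteq> {xs. set xs \<subseteq> V \<and> length xs = r}"
      using rich_sub by (auto simp: W_def)
    from N[OF V(1) _ this] obtain As where As: "length As = r" "\<forall>A\<in>set As. A \<subseteq> V \<and> card A = t"
        "listset As \<subseteq> {w\<in>rich. X \<subseteq> nb w}"
      using V(2) X(2) by (auto simp: n_def)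
    then have "listset (X # As) \<subseteq> T"
      by (auto simp: set_Cons_def nb_def)
    then show ?thesis
      using As X(1) by (intro exI[of _ "X # As"]) (auto simp: Xs_def)
  qed
  then show ?case
    by blast
qed

section \<open>Monochromatic copies and cliques\<close>

text \<open>
  The copy is replaced by an embedding of \<open>H\<close>; embeddings compose with one another, and restrict to cliques.
\<close>

lemma has_monochromatic_copy_iff:
  assumes "simple_graph H" and "simple_graph G"
  shows "has_monochromatic_copy H G c \<longleftrightarrow>
           (\<exists>f k. inj_on f (verts H) \<and> f ` verts H \<subseteq> verts G \<and>
              (\<forall>e\<in>edges H. f ` e \<in> edges G \<and> c (f ` e) = k))"
proof
  assume "has_monochromatic_copy H G c"
  then obtain S g k where S: "subgraph S G" "bij_betw g (verts S) (verts H)"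
      "edges H = (\<lambda>e. g ` e) ` edges S" "\<forall>e\<in>edges S. c e = k"
    by (auto simp: has_monochromatic_copy_def graph_iso_def)
  define f where "f = inv_into (verts S) g"
  have f: "bij_betw f (verts H) (verts S)"
    using S(2) by (simp add: f_def bij_betw_inv_into)
  have "f ` g ` e = e" if "e \<in> edges S" for e
  proof -
    have "e \<subseteq> verts S"
      using S(1) that by (auto simp: subgraph_def simple_graph_def)
    then show ?thesis
      using S(2) by (simp add: f_def bij_betw_def inv_into_image_cancel)
  qed
  then have "\<forall>e\<in>edges H. f ` e \<in> edges G \<and> c (f ` e) = k"
    using S by (auto simp: subgraph_def)
  moreover have "inj_on f (verts H)" "f ` verts H \<subseteq> verts G"
    using f S(1) by (auto simp: bij_betw_def subgraph_def)
  ultimately show "\<exists>f k. inj_on f (verts H) \<and> f ` verts H \<subseteq> verts G \<and>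
      (\<forall>e\<in>edges H. f ` e \<in> edges G \<and> c (f ` e) = k)"
    by (intro exI[of _ f] exI[of _ k] conjI)
next
  assume "\<exists>f k. inj_on f (verts H) \<and> f ` verts H \<subseteq> verts G \<and>
      (\<forall>e\<in>edges H. f ` e \<in> edges G \<and> c (f ` e) = k)"
  then obtain f k where f: "inj_on f (verts H)" "f ` verts H \<subseteq> verts G"
      "\<forall>e\<in>edges H. f ` e \<in> edges G \<and> c (f ` e) = k"
    by (elim exE conjE) (rule that)
  define S where "S = \<lparr>verts = f ` verts H, edges = (\<lambda>e. f ` e) ` edges H\<rparr>"
  have H: "finite (verts H)" "\<And>e. e \<in> edges H \<Longrightarrow> e \<subseteq> verts H" "\<And>e. e \<in> edges H \<Longrightarrow> card e = 2"
    using assms(1) by (auto simp: simple_graph_def)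
  have "card (f ` e) = 2" if "e \<in> edges H" for e
    using H(2,3)[OF that] inj_on_subset[OF f(1)] by (simp add: card_image)
  then have "subgraph S G"
    using H f by (auto simp: subgraph_def simple_graph_def S_def)
  moreover have "graph_iso S H"
    unfolding graph_iso_def
  proof (intro exI conjI)
    show "bij_betw (inv_into (verts H) f) (verts S) (verts H)"
      using f(1) by (simp add: S_def bij_betw_inv_into inj_on_imp_bij_betw)
    have "inv_into (verts H) f ` f ` e = e" if "e \<in> edges H" for e
      using H(2)[OF that] f(1) by (simp add: inv_into_image_cancel)
    then show "edges H = (\<lambda>e. inv_into (verts H) f ` e) ` edges S"
      by (simp add: S_def image_image)
  qed
  moreover have "\<forall>e\<in>edges S. c e = k"
    using f(3) by (simp add: S_def)
  ultimately show "has_monochromatic_copy H G c"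
    by (auto simp: has_monochromatic_copy_def)
qed

text \<open>
  Cliques are kept as lists, so that they live among the \<open>n ^ r\<close> tuples of vertices that are sampled
  and counted below, and so that maps of vertices act on them by \<^const>\<open>map\<close>.
\<close>

definition mono_cliques :: "'a sgraph \<Rightarrow> ('a set \<Rightarrow> nat) \<Rightarrow> nat \<Rightarrow> nat \<Rightarrow> 'a list set" where
  "mono_cliques G c r k = {xs. set xs \<subseteq> verts G \<and> length xs = r \<and>
     sorted_wrt (\<lambda>x y. {x, y} \<in> edges G \<and> c {x, y} = k) xs}"

lemma edge_ends_distinct: "simple_graph G \<Longrightarrow> {x, y} \<in> edges G \<Longrightarrow> x \<noteq> y"
  by (auto simp: simple_graph_def)

lemma edge_ends_in_verts: "simple_graph G \<Longrightarrow> {x, y} \<in> edges G \<Longrightarrow> x \<in> verts G \<and> y \<in> verts G"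
  by (auto simp: simple_graph_def)

lemma edge_obtain_ends:
  assumes "simple_graph G" and "e \<in> edges G"
  obtains u v where "e = {u, v}" and "u \<noteq> v" and "u \<in> verts G" and "v \<in> verts G"
proof -
  have e: "card e = 2" "e \<subseteq> verts G"
    using assms by (auto simp: simple_graph_def)
  then obtain u v where "e = {u, v}" "u \<noteq> v"
    by (auto simp: card_2_iff)
  then show ?thesis
    using that e(2) by blast
qed

lemma finite_edges: "simple_graph G \<Longrightarrow> finite (edges G)"
  by (rule finite_subset[of _ "Pow (verts G)"]) (auto simp: simple_graph_def)

lemma mono_clique_distinct:
  assumes "simple_graph G" and "xs \<in> mono_cliques G c r k"
  shows "distinct xs"
proof -
  have "sorted_wrt (\<noteq>) xs"
    using assms edge_ends_distinct[OF assms(1)]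
    by (auto simp: mono_cliques_def intro: sorted_wrt_mono_rel[rotated])
  then show ?thesis
    by (simp add: distinct_conv_nth sorted_wrt_iff_nth_less) (metis linorder_neqE_nat)
qed

lemma mono_clique_nth:
  assumes "xs \<in> mono_cliques G c r k" and "i < r" and "j < r" and "i \<noteq> j"
  shows "{xs ! i, xs ! j} \<in> edges G \<and> c {xs ! i, xs ! j} = k"
proof -
  have less: "{xs ! i, xs ! j} \<in> edges G \<and> c {xs ! i, xs ! j} = k" if "i < j" "j < r" for i j
    using assms(1) that by (auto simp: mono_cliques_def sorted_wrt_iff_nth_less)
  show ?thesis
    using less[of i j] less[of j i] assms(2-4) by (metis insert_commute linorder_neqE_nat)
qed

lemma simple_complete_graph: "simple_graph (complete_graph r)"
  by (auto simp: simple_graph_def complete_graph_def)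

lemma has_monochromatic_clique_iff:
  assumes "simple_graph G"
  shows "has_monochromatic_copy (complete_graph r) G c \<longleftrightarrow> (\<exists>k. mono_cliques G c r k \<noteq> {})"
proof
  assume "has_monochromatic_copy (complete_graph r) G c"
  then obtain f k where f: "inj_on f {..<r}" "f ` {..<r} \<subseteq> verts G"
      "\<And>e. e \<subseteq> {..<r} \<Longrightarrow> card e = 2 \<Longrightarrow> f ` e \<in> edges G \<and> c (f ` e) = k"
    unfolding has_monochromatic_copy_iff[OF simple_complete_graph assms]
    by (auto simp: complete_graph_def)
  have "map f [0..<r] \<in> mono_cliques G c r k"
    using f(2) f(3)[of "{_, _}"] by (auto simp: mono_cliques_def sorted_wrt_iff_nth_less)
  then show "\<exists>k. mono_cliques G c r k \<noteq> {}"
    by blast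
next
  assume "\<exists>k. mono_cliques G c r k \<noteq> {}"
  then obtain k xs where xs: "xs \<in> mono_cliques G c r k"
    by blast
  have "inj_on ((!) xs) {..<r}"
    using mono_clique_distinct[OF assms xs] xs
    by (auto simp: inj_on_def nth_eq_iff_index_eq mono_cliques_def)
  moreover have "(!) xs ` {..<r} \<subseteq> verts G"
    using xs by (auto simp: mono_cliques_def)
  moreover have "(!) xs ` e \<in> edges G \<and> c ((!) xs ` e) = k" if "e \<subseteq> {..<r}" "card e = 2" for e
    using that mono_clique_nth[OF xs] by (auto simp: card_2_iff)
  ultimately show "has_monochromatic_copy (complete_graph r) G c"
    unfolding has_monochromatic_copy_iff[OF simple_complete_graph assms]
    by (intro exI[of _ "(!) xs"] exI[of _ k]) (auto simp: complete_graph_def)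
qed

text \<open>
  A vertex of \<open>H\<close> in the color class \<open>i\<close> is sent to the side \<open>A\<^sub>i\<close>. Any two vertices on different sides lie on
  a common transversal of the box, which is a monochromatic clique, so they are joined in the color
  \<open>k\<close>; in particular the sides are disjoint.
\<close>

lemma monochromatic_copy_from_box:
  assumes H: "simple_graph H" and col: "proper_vertex_coloring H r col" and "verts H \<noteq> {}"
    and G: "simple_graph G"
    and As: "length As = r" "\<And>A. A \<in> set As \<Longrightarrow> card A = card (verts H)"
    and As_sub: "\<And>A. A \<in> set As \<Longrightarrow> A \<subseteq> verts G"
    and box: "listset As \<subseteq> mono_cliques G c r k"
  shows "has_monochromatic_copy H G c"
proof -
  have finH: "finite (verts H)"
    using H by (simp add: simple_graph_def)
  then have "card (verts H) > 0"
    using assms(3) by (simp add: card_gt_0_iff)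
  have As_nth: "finite (As ! i) \<and> As ! i \<noteq> {} \<and> card (As ! i) = card (verts H)" if "i < r" for i
  proof -
    have "card (As ! i) = card (verts H)"
      using that As by simp
    then show ?thesis
      using \<open>card (verts H) > 0\<close> by (metis card.empty card.infinite less_irrefl)
  qed
  have "\<exists>g. bij_betw g (verts H) (As ! i)" if "i < r" for i
    using As_nth[OF that] finH by (metis finite_same_card_bij)
  then obtain g where g: "\<And>i. i < r \<Longrightarrow> bij_betw (g i) (verts H) (As ! i)"
    by metis
  have transversal: "{x, y} \<in> edges G \<and> c {x, y} = k"
    if "i < r" "j < r" "i \<noteq> j" "x \<in> As ! i" "y \<in> As ! j" for i j x y
  proof -
    have "\<forall>l. \<exists>y. l < r \<longrightarrow> y \<in> As ! l"
      using As_nth by blast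
    then obtain p where p: "\<And>l. l < r \<Longrightarrow> p l \<in> As ! l"
      by metis
    define xs where "xs = map (p(i := x, j := y)) [0..<r]"
    have "list_all2 (\<in>) xs As"
      using that p As(1) by (auto simp: xs_def list_all2_conv_all_nth)
    then have "xs \<in> listset As"
      by (induction rule: list_all2_induct) (auto simp: set_Cons_def)
    then have "xs \<in> mono_cliques G c r k"
      using box by blast
    from mono_clique_nth[OF this that(1-3)] show ?thesis
      using that by (simp add: xs_def)
  qed
  define f where "f v = g (col v) v" for v
  have col_less: "col v < r" if "v \<in> verts H" for v
    using col that by (simp add: proper_vertex_coloring_def)
  have f_in: "f v \<in> As ! col v" if "v \<in> verts H" for v
    using g[OF col_less[OF that]] that by (auto simp: f_def bij_betw_def)
  have sides: "{f u, f v} \<in> edges G \<and> c {f u, f v} = k"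
    if "u \<in> verts H" "v \<in> verts H" "col u \<noteq> col v" for u v
    using that transversal col_less f_in by blast
  have "inj_on f (verts H)"
  proof (rule inj_onI)
    fix u v assume uv: "u \<in> verts H" "v \<in> verts H" "f u = f v"
    have "col u = col v"
      using sides[OF uv(1,2)] edge_ends_distinct[OF G] uv(3) by blast
    then show "u = v"
      using uv g[OF col_less[OF uv(1)]] by (auto simp: f_def bij_betw_def inj_on_def)
  qed
  moreover have edges: "f ` e \<in> edges G \<and> c (f ` e) = k" if e: "e \<in> edges H" for e
  proof -
    obtain u v where "e = {u, v}" "u \<in> verts H" "v \<in> verts H"
      using edge_obtain_ends[OF H e] by metis
    then show ?thesis
      using sides[of u v] e col by (auto simp: proper_vertex_coloring_def)
  qed
  moreover have "f ` verts H \<subseteq> verts G"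
  proof (rule image_subsetI)
    fix v assume v: "v \<in> verts H"
    then have "As ! col v \<in> set As"
      using col_less As(1) by simp
    then show "f v \<in> verts G"
      using f_in[OF v] As_sub by blast
  qed
  ultimately show ?thesis
    unfolding has_monochromatic_copy_iff[OF H G] by (intro exI[of _ f] exI[of _ k] conjI ballI) simp_all
qed

section \<open>Pulling back and blowing up colored graphs\<close>

text \<open>
  One construction serves two purposes. For a random \<open>\<pi>\<close> from a small set into the vertices of \<open>G\<close> it is a
  sample of \<open>G\<close>; for \<open>\<pi>\<close> with large fibres it is a blow-up of \<open>G\<close>. A point of \<open>W\<close> that \<open>\<pi>\<close> sends outside
  \<open>G\<close> becomes isolated.
\<close>

definition pullback :: "'b set \<Rightarrow> ('b \<Rightarrow> 'a) \<Rightarrow> 'a sgraph \<Rightarrow> 'b sgraph" where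
  "pullback W \<pi> G = \<lparr>verts = W, edges = {e. e \<subseteq> W \<and> card e = 2 \<and> \<pi> ` e \<in> edges G}\<rparr>"

lemma verts_pullback [simp]: "verts (pullback W \<pi> G) = W"
  by (simp add: pullback_def)

lemma simple_pullback: "finite W \<Longrightarrow> simple_graph (pullback W \<pi> G)"
  by (auto simp: pullback_def simple_graph_def)

lemma edge_pullback_iff:
  assumes "simple_graph G"
  shows "{x, y} \<in> edges (pullback W \<pi> G) \<longleftrightarrow> x \<in> W \<and> y \<in> W \<and> {\<pi> x, \<pi> y} \<in> edges G"
proof -
  have "{x, y} \<in> edges (pullback W \<pi> G) \<longleftrightarrow>
      x \<in> W \<and> y \<in> W \<and> card {x, y} = 2 \<and> {\<pi> x, \<pi> y} \<in> edges G"
    by (simp add: pullback_def)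
  then show ?thesis
    using edge_ends_distinct[OF assms, of "\<pi> x" "\<pi> y"] by (cases "x = y") auto
qed

lemma incident_colors_pullback:
  "incident_colors (pullback W \<pi> G) (\<lambda>e. c (\<pi> ` e)) x \<subseteq> incident_colors G c (\<pi> x)"
  by (auto simp: incident_colors_def pullback_def)

lemma finite_incident_colors: "simple_graph G \<Longrightarrow> finite (incident_colors G c v)"
  by (simp add: incident_colors_def finite_edges)

lemma card_incident_colors_pullback:
  assumes "simple_graph G"
  shows "card (incident_colors (pullback W \<pi> G) (\<lambda>e. c (\<pi> ` e)) x) \<le> card (incident_colors G c (\<pi> x))"
  by (intro card_mono finite_incident_colors assms incident_colors_pullback)

text \<open>
  Although \<open>\<pi>\<close> may identify points, it is injective on cliques, as \<open>G\<close> has no loops. For \<open>r = 1\<close> the claim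
  would fail, because a point of \<open>W\<close> may be sent outside \<open>G\<close>.
\<close>

lemma map_mono_clique_pullback:
  assumes "simple_graph G" and "r \<ge> 2"
    and "xs \<in> mono_cliques (pullback W \<pi> G) (\<lambda>e. c (\<pi> ` e)) r k"
  shows "map \<pi> xs \<in> mono_cliques G c r k"
proof -
  have xs: "set xs \<subseteq> W" "length xs = r"
      "sorted_wrt (\<lambda>x y. {x, y} \<in> edges (pullback W \<pi> G) \<and> c (\<pi> ` {x, y}) = k) xs"
    using assms(3) by (auto simp: mono_cliques_def)
  have "\<pi> x \<in> verts G" if x: "x \<in> set xs" for x
  proof -
    obtain i where i: "i < r" "x = xs ! i"
      using x xs(2) by (metis in_set_conv_nth)
    obtain j where "j < r" "j \<noteq> i"
      using \<open>r \<ge> 2\<close> that[of "if i = 0 then 1 else 0"] by (auto split: if_splits)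
    then have "{x, xs ! j} \<in> edges (pullback W \<pi> G)"
      using mono_clique_nth[OF assms(3) i(1)] i(2) by auto
    then show ?thesis
      using edge_ends_in_verts[OF assms(1), of "\<pi> x" "\<pi> (xs ! j)"] by (simp add: edge_pullback_iff[OF assms(1)])
  qed
  moreover have "sorted_wrt (\<lambda>x y. {\<pi> x, \<pi> y} \<in> edges G \<and> c {\<pi> x, \<pi> y} = k) xs"
    by (rule sorted_wrt_mono_rel[OF _ xs(3)]) (simp add: edge_pullback_iff[OF assms(1)])
  ultimately show ?thesis
    using xs(2) by (auto simp: mono_cliques_def sorted_wrt_map)
qed

text \<open>
  Edges are counted through ordered pairs of vertices, as sums over pairs are easy to transport
  along maps.
\<close>

lemma sum_adjacency:
  assumes "simple_graph G"
  shows "(\<Sum>u\<in>verts G. \<Sum>v\<in>verts G. of_bool ({u, v} \<in> edges G)) = 2 * real (card (edges G))"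
proof -
  have fin: "finite (verts G)"
    using assms by (simp add: simple_graph_def)
  let ?P = "{(u, v) \<in> verts G \<times> verts G. {u, v} \<in> edges G}"
  have "finite ?P"
    using fin by (rule_tac finite_subset[of _ "verts G \<times> verts G"]) auto
  have two: "card {p\<in>?P. (case p of (u, v) \<Rightarrow> {u, v}) = e} = 2" if e: "e \<in> edges G" for e
  proof -
    obtain u v where uv: "e = {u, v}" "u \<noteq> v" "u \<in> verts G" "v \<in> verts G"
      using edge_obtain_ends[OF assms e] by metis
    have "{p\<in>?P. (case p of (u, v) \<Rightarrow> {u, v}) = e} = {(u, v), (v, u)}"
      using uv e by (auto simp: doubleton_eq_iff insert_commute)
    then show ?thesis
      using uv(2) by simp
  qed
  have "card ?P = (\<Sum>p\<in>?P. 1)"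
    by simp
  also have "\<dots> = (\<Sum>e\<in>edges G. \<Sum>p\<in>{p\<in>?P. (case p of (u, v) \<Rightarrow> {u, v}) = e}. 1)"
    by (rule sum.group[symmetric, OF \<open>finite ?P\<close> finite_edges[OF assms]]) auto
  also have "\<dots> = (\<Sum>e\<in>edges G. 2)"
    by (intro sum.cong refl) (simp only: two card_eq_sum[symmetric])
  finally have "real (card ?P) = 2 * real (card (edges G))"
    by simp
  moreover have "(\<Sum>u\<in>verts G. \<Sum>v\<in>verts G. of_bool ({u, v} \<in> edges G)) = real (card ?P)"
  proof -
    have "(\<Sum>p\<in>verts G \<times> verts G. case p of (u, v) \<Rightarrow> of_bool ({u, v} \<in> edges G)) = (\<Sum>p\<in>?P. 1 :: real)"
      using fin by (intro sum.mono_neutral_cong_right) auto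
    then show ?thesis
      by (simp add: sum.cartesian_product)
  qed
  ultimately show ?thesis
    by simp
qed

lemma sum_adjacency_pullback:
  assumes "simple_graph G" and "finite W"
  shows "2 * real (card (edges (pullback W \<pi> G))) = (\<Sum>x\<in>W. \<Sum>y\<in>W. of_bool ({\<pi> x, \<pi> y} \<in> edges G))"
  by (simp add: sum_adjacency[OF simple_pullback[OF assms(2)], symmetric] edge_pullback_iff[OF assms(1)])

lemma sum_blocks:
  fixes f :: "nat \<Rightarrow> real"
  assumes "m * s \<le> n" and "\<And>i. i \<ge> s \<Longrightarrow> f i = 0" and "m > 0"
  shows "(\<Sum>x<n. f (x div m)) = real m * (\<Sum>i<s. f i)"
proof -
  have "(\<Sum>x<n. f (x div m)) = (\<Sum>x<s * m. f (x div m))"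
    using assms
    by (intro sum.mono_neutral_right) (auto simp: mult.commute less_eq_div_iff_mult_less_eq not_less)
  also have "\<dots> = (\<Sum>i<s. \<Sum>x = i * m..<i * m + m. f (x div m))"
    by (rule sum.nat_group[symmetric])
  also have "\<dots> = (\<Sum>i<s. \<Sum>x = i * m..<i * m + m. f i)"
  proof (intro sum.cong refl)
    fix i x assume "x \<in> {i * m..<i * m + m}"
    then have "x div m = i"
      by (intro div_nat_eqI) (auto simp: mult.commute)
    then show "f (x div m) = f i"
      by simp
  qed
  finally show ?thesis
    by (simp add: sum_distrib_left)
qed

definition color_total :: "'a sgraph \<Rightarrow> ('a set \<Rightarrow> nat) \<Rightarrow> real" where
  "color_total G c = (\<Sum>v\<in>verts G. real (card (incident_colors G c v)))"

text \<open>
  Without the denominator the empty graph, whose mean is \<open>0 / 0 = 0\<close>, needs no separate treatment later.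
\<close>

lemma mean_coloring_iff_color_total:
  assumes "\<rho> \<ge> 0" and "simple_graph G"
  shows "mean_coloring \<rho> G c \<longleftrightarrow> color_total G c \<le> \<rho> * real (card (verts G))"
proof (cases "card (verts G) = 0")
  case True
  then have "verts G = {}"
    using assms(2) by (simp add: simple_graph_def)
  then show ?thesis
    using assms(1) by (simp add: mean_coloring_def color_total_def)
qed (simp add: mean_coloring_def color_total_def pos_divide_le_eq)

lemma card_edges_le_RT:
  fixes G :: "nat sgraph"
  assumes "simple_graph G" and "mean_coloring \<rho> G c" and "\<not> has_monochromatic_copy H G c"
  shows "card (edges G) \<le> RT (card (verts G)) H \<rho>"
proof -
  have "card (edges G) \<in> RT_edge_counts (card (verts G)) H \<rho>"
    unfolding RT_edge_counts_def using assms by blast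
  then show ?thesis
    unfolding RT_def by (intro Max_ge finite_RT_edge_counts)
qed

text \<open>
  The map \<open>x \<mapsto> x div m\<close> replaces each vertex of \<open>Q\<close> by \<open>m\<close> independent copies and sends the remaining
  \<open>n - ms\<close> points to numbers that are not vertices of \<open>Q\<close>, so these points are isolated and meet no color. A sum of
  color numbers up to \<open>\<rho>n / m\<close> is therefore admissible for \<open>Q\<close>, even if its own mean exceeds \<open>\<rho>\<close>.
\<close>

lemma blow_up_le_RT:
  fixes Q :: "nat sgraph"
  assumes Q: "simple_graph Q" "verts Q = {..<s}" and "r \<ge> 2"
    and free: "\<not> has_monochromatic_copy (complete_graph r) Q c"
    and size: "m * s \<le> n" and total: "real m * color_total Q c \<le> \<rho> * real n" and "\<rho> \<ge> 0"
  shows "m ^ 2 * card (edges Q) \<le> RT n (complete_graph r) \<rho>"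
proof (cases "m = 0")
  case False
  define B where "B = pullback {..<n} (\<lambda>x. x div m) Q"
  define c' where "c' = (\<lambda>e. c ((\<lambda>x. x div m) ` e))"
  have no_edge: "{i, j} \<notin> edges Q" if "i \<ge> s \<or> j \<ge> s" for i j
    using that edge_ends_in_verts[OF Q(1), of i j] unfolding Q(2) by (meson lessThan_iff not_le)
  have no_color: "incident_colors Q c i = {}" if "i \<ge> s" for i
  proof -
    have "i \<notin> verts Q"
      using that Q(2) by simp
    then show ?thesis
      using Q(1) unfolding incident_colors_def simple_graph_def by blast
  qed
  have simple_B: "simple_graph B"
    by (simp add: B_def simple_pullback)
  have "color_total B c' \<le> (\<Sum>x<n. real (card (incident_colors Q c (x div m))))"
    using card_incident_colors_pullback[OF Q(1), of "{..<n}" "\<lambda>x. x div m" c]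
    by (auto simp: color_total_def B_def c'_def intro!: sum_mono)
  also have "\<dots> = real m * color_total Q c"
    using size False no_color by (subst sum_blocks[of m s]) (auto simp: color_total_def Q(2))
  finally have "mean_coloring \<rho> B c'"
    using total \<open>\<rho> \<ge> 0\<close> simple_B by (simp add: mean_coloring_iff_color_total) (simp add: B_def)
  moreover have "\<not> has_monochromatic_copy (complete_graph r) B c'"
    using free map_mono_clique_pullback[OF Q(1) \<open>r \<ge> 2\<close>, of _ "{..<n}" "\<lambda>x. x div m" c]
    unfolding has_monochromatic_clique_iff[OF Q(1)] has_monochromatic_clique_iff[OF simple_B]
    by (auto simp: B_def c'_def)
  ultimately have "card (edges B) \<le> RT n (complete_graph r) \<rho>"
    using card_edges_le_RT[OF simple_B] by (simp add: B_def)
  moreover have "2 * real (card (edges B)) = real m ^ 2 * (2 * real (card (edges Q)))"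
  proof -
    have "2 * real (card (edges B)) = (\<Sum>x<n. \<Sum>y<n. of_bool ({x div m, y div m} \<in> edges Q))"
      unfolding B_def by (rule sum_adjacency_pullback[OF Q(1)]) simp
    also have "\<dots> = (\<Sum>x<n. real m * (\<Sum>j<s. of_bool ({x div m, j} \<in> edges Q)))"
      using size False no_edge by (intro sum.cong refl sum_blocks) auto
    also have "\<dots> = real m * (\<Sum>i<s. real m * (\<Sum>j<s. of_bool ({i, j} \<in> edges Q)))"
      using size False no_edge by (intro sum_blocks) auto
    also have "\<dots> = real m ^ 2 * (2 * real (card (edges Q)))"
      by (simp add: sum_adjacency[OF Q(1), symmetric] Q(2) sum_distrib_left power2_eq_square mult_ac)
    finally show ?thesis .
  qed
  then have "real (card (edges B)) = real (m ^ 2 * card (edges Q))"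
    by simp
  ultimately show ?thesis
    by linarith
qed simp

section \<open>Random samples\<close>

text \<open>
  The uniform distribution on maps \<open>\<phi>\<close> from \<open>I\<close> to \<open>V\<close> makes the values \<open>\<phi> i\<close> independent and uniform.
  Probabilities are expressed by counting, with the powers of \<open>card V\<close> multiplied out instead of divided.
\<close>

lemma card_PiE_prescribed:
  assumes "finite I" and "finite V" and "J \<subseteq> I" and "\<And>j. j \<in> J \<Longrightarrow> w j \<in> V"
  shows "card {\<phi> \<in> I \<rightarrow>\<^sub>E V. \<forall>j\<in>J. \<phi> j = w j} * card V ^ card J = card V ^ card I"
proof -
  have "{\<phi> \<in> I \<rightarrow>\<^sub>E V. \<forall>j\<in>J. \<phi> j = w j} = (\<Pi>\<^sub>E i\<in>I. if i \<in> J then {w i} else V)"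
  proof (intro equalityI subsetI)
    fix \<phi> assume \<phi>: "\<phi> \<in> (\<Pi>\<^sub>E i\<in>I. if i \<in> J then {w i} else V)"
    have "\<phi> i \<in> V" if "i \<in> I" for i
      using PiE_mem[OF \<phi> that] assms(4) by (auto split: if_splits)
    moreover have "\<phi> j = w j" if "j \<in> J" for j
      using PiE_mem[OF \<phi>, of j] assms(3) that by auto
    moreover have "\<phi> \<in> extensional I"
      using \<phi> by (simp add: PiE_def)
    ultimately show "\<phi> \<in> {\<phi> \<in> I \<rightarrow>\<^sub>E V. \<forall>j\<in>J. \<phi> j = w j}"
      by (simp add: PiE_def Pi_def)
  qed (auto simp: PiE_def Pi_def)
  moreover have "card (\<Pi>\<^sub>E i\<in>I. if i \<in> J then {w i} else V) = card V ^ card (I - J)"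
  proof -
    have "card (\<Pi>\<^sub>E i\<in>I. if i \<in> J then {w i} else V) = (\<Prod>i\<in>I. if i \<in> J then 1 else card V)"
      using assms(1) by (simp add: card_PiE if_distrib cong: if_cong)
    also have "\<dots> = (\<Prod>i\<in>I - J. card V)"
      using assms(1) by (intro prod.mono_neutral_cong_right) auto
    finally show ?thesis
      by simp
  qed
  moreover have "card (I - J) + card J = card I"
    using assms(1,3) by (metis card_Diff_subset card_mono finite_subset le_add_diff_inverse2)
  ultimately show ?thesis
    by (metis power_add)
qed

lemma sum_samples_two:
  fixes g :: "'a \<Rightarrow> 'a \<Rightarrow> real"
  assumes "finite I" and "finite V" and "i \<in> I" and "j \<in> I" and "i \<noteq> j"
  shows "(\<Sum>\<phi>\<in>I \<rightarrow>\<^sub>E V. g (\<phi> i) (\<phi> j)) * real (card V) ^ 2 =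
           real (card V) ^ card I * (\<Sum>u\<in>V. \<Sum>v\<in>V. g u v)"
proof -
  let ?F = "\<lambda>p. {\<phi> \<in> I \<rightarrow>\<^sub>E V. (\<phi> i, \<phi> j) = p}"
  have fiber: "real (card (?F p)) * real (card V) ^ 2 = real (card V) ^ card I" if "p \<in> V \<times> V" for p
  proof -
    have "?F p = {\<phi> \<in> I \<rightarrow>\<^sub>E V. \<forall>k\<in>{i, j}. \<phi> k = (if k = i then fst p else snd p)}"
      using assms(5) by (cases p) auto
    moreover have "card {\<phi> \<in> I \<rightarrow>\<^sub>E V. \<forall>k\<in>{i, j}. \<phi> k = (if k = i then fst p else snd p)} *
        card V ^ card {i, j} = card V ^ card I"
      using assms that by (intro card_PiE_prescribed) auto
    ultimately have "card (?F p) * card V ^ 2 = card V ^ card I"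
      using assms(5) by (simp add: power2_eq_square)
    then have "real (card (?F p) * card V ^ 2) = real (card V ^ card I)"
      by (simp only:)
    then show ?thesis
      by (simp only: of_nat_mult of_nat_power)
  qed
  have "(\<Sum>\<phi>\<in>I \<rightarrow>\<^sub>E V. g (\<phi> i) (\<phi> j)) = (\<Sum>p\<in>V \<times> V. \<Sum>\<phi>\<in>?F p. g (\<phi> i) (\<phi> j))"
    using assms by (intro sum.group[symmetric]) (auto simp: finite_PiE)
  also have "\<dots> = (\<Sum>p\<in>V \<times> V. real (card (?F p)) * g (fst p) (snd p))"
    by (intro sum.cong refl) auto
  finally have "(\<Sum>\<phi>\<in>I \<rightarrow>\<^sub>E V. g (\<phi> i) (\<phi> j)) * real (card V) ^ 2 =
      (\<Sum>p\<in>V \<times> V. (real (card (?F p)) * real (card V) ^ 2) * g (fst p) (snd p))"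
    by (simp add: sum_distrib_left mult_ac)
  also have "\<dots> = (\<Sum>p\<in>V \<times> V. real (card V) ^ card I * g (fst p) (snd p))"
    by (intro sum.cong refl) (simp only: fiber)
  also have "\<dots> = real (card V) ^ card I * (\<Sum>u\<in>V. \<Sum>v\<in>V. g u v)"
    by (simp add: sum_distrib_left sum.cartesian_product case_prod_unfold)
  finally show ?thesis .
qed

text \<open>
  Chebyshev's inequality: the values \<open>a (\<phi> i)\<close> are independent and centred, so in the second moment of their
  sum only the \<open>s\<close> diagonal terms survive, each at most \<open>D\<^sup>2\<close>.
\<close>

lemma sample_sum_concentration:
  fixes a :: "'a \<Rightarrow> real"
  assumes "finite V" and "V \<noteq> {}" and centred: "(\<Sum>v\<in>V. a v) = 0"
    and bound: "\<And>v. v \<in> V \<Longrightarrow> \<bar>a v\<bar> \<le> D" and "\<delta> > 0" and "s > 0"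
  shows "real (card {\<phi> \<in> {..<s} \<rightarrow>\<^sub>E V. (\<Sum>i<s. a (\<phi> i)) > \<delta> * s}) * (\<delta>\<^sup>2 * s) \<le>
           D\<^sup>2 * real (card V) ^ s"
proof -
  define P where "P = {..<s} \<rightarrow>\<^sub>E V"
  define n where "n = card V"
  have finP: "finite P"
    using assms(1) by (simp add: P_def finite_PiE)
  have "n > 0"
    using assms(1,2) by (simp add: n_def card_gt_0_iff)
  have pair: "(\<Sum>\<phi>\<in>P. a (\<phi> i) * a (\<phi> j)) \<le> (if i = j then D\<^sup>2 * real n ^ s else 0)"
    if "i < s" "j < s" for i j
  proof (cases "i = j")
    case True
    have "(\<Sum>\<phi>\<in>P. a (\<phi> i) * a (\<phi> j)) \<le> (\<Sum>\<phi>\<in>P. D\<^sup>2)"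
    proof (rule sum_mono)
      fix \<phi> assume "\<phi> \<in> P"
      then have "\<bar>a (\<phi> i)\<bar> \<le> D"
        using that by (intro bound) (auto simp: P_def)
      then show "a (\<phi> i) * a (\<phi> j) \<le> D\<^sup>2"
        using True power_mono[of "\<bar>a (\<phi> i)\<bar>" D 2] by (simp add: power2_eq_square)
    qed
    also have "\<dots> = D\<^sup>2 * real n ^ s"
      by (simp add: P_def card_PiE n_def)
    finally show ?thesis
      using True by simp
  next
    case False
    have "(\<Sum>\<phi>\<in>P. a (\<phi> i) * a (\<phi> j)) * real n ^ 2 = 0"
      using sum_samples_two[of "{..<s}" V i j "\<lambda>u v. a u * a v"] that False assms(1) centred
      by (simp add: P_def n_def flip: sum_distrib_left)
    then show ?thesis
      using \<open>n > 0\<close> False by simp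
  qed
  define bad where "bad = {\<phi> \<in> P. (\<Sum>i<s. a (\<phi> i)) > \<delta> * s}"
  have "real (card bad) * (\<delta> * s)\<^sup>2 = (\<Sum>\<phi>\<in>bad. (\<delta> * s)\<^sup>2)"
    by simp
  also have "\<dots> \<le> (\<Sum>\<phi>\<in>bad. (\<Sum>i<s. a (\<phi> i))\<^sup>2)"
    using assms(5) by (intro sum_mono power_mono) (auto simp: bad_def)
  also have "\<dots> \<le> (\<Sum>\<phi>\<in>P. (\<Sum>i<s. a (\<phi> i))\<^sup>2)"
    using finP by (intro sum_mono2) (auto simp: bad_def)
  also have "\<dots> = (\<Sum>i<s. \<Sum>j<s. \<Sum>\<phi>\<in>P. a (\<phi> i) * a (\<phi> j))"
    unfolding power2_eq_square sum_product by (subst sum.swap) (intro sum.cong refl sum.swap)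
  also have "\<dots> \<le> (\<Sum>i<s. \<Sum>j<s. if i = j then D\<^sup>2 * real n ^ s else 0)"
    by (intro sum_mono pair) auto
  also have "\<dots> = s * (D\<^sup>2 * real n ^ s)"
    by simp
  finally have "(real (card bad) * (\<delta>\<^sup>2 * s)) * s \<le> (D\<^sup>2 * real n ^ s) * s"
    by (simp add: power_mult_distrib power2_eq_square mult_ac)
  then have "real (card bad) * (\<delta>\<^sup>2 * s) \<le> D\<^sup>2 * real n ^ s"
    using assms(6) by (simp add: mult_le_cancel_right)
  then show ?thesis
    by (simp add: bad_def P_def n_def)
qed

text \<open>
  A union bound over at most \<open>s ^ r\<close> lists of distinct indices: for each of them the tuple \<open>map \<phi> is\<close> is uniformly distributed.
  It turns a positive proportion of samples with a clique into a positive proportion of cliques among all tuples.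
\<close>

lemma samples_hitting_tuples:
  assumes "finite V" and "T \<subseteq> {xs. set xs \<subseteq> V \<and> length xs = r}"
  shows "card {\<phi> \<in> {..<s} \<rightarrow>\<^sub>E V. \<exists>is. set is \<subseteq> {..<s} \<and> distinct is \<and> length is = r \<and> map \<phi> is \<in> T}
           * card V ^ r \<le> s ^ r * card T * card V ^ s"
proof -
  define P where "P = {..<s} \<rightarrow>\<^sub>E V"
  define L where "L = {is. set is \<subseteq> {..<s} \<and> length is = r}"
  let ?F = "\<lambda>is xs. {\<phi> \<in> P. distinct is \<and> map \<phi> is = xs}"
  have fin: "finite P" "finite L" "finite T"
    using assms finite_lists_length_eq[OF assms(1), of r] finite_lists_length_eq[of "{..<s}" r]
    by (auto simp: P_def L_def finite_PiE intro: finite_subset)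
  have fiber: "card (?F is xs) * card V ^ r \<le> card V ^ s" if "is \<in> L" "xs \<in> T" for "is" xs
  proof (cases "?F is xs = {}")
    case False
    then obtain \<psi> where \<psi>: "\<psi> \<in> P" "distinct is" "map \<psi> is = xs"
      by blast
    have "?F is xs = {\<phi> \<in> P. \<forall>j\<in>set is. \<phi> j = \<psi> j}"
      using \<psi> by auto
    moreover have "card {\<phi> \<in> P. \<forall>j\<in>set is. \<phi> j = \<psi> j} * card V ^ card (set is) = card V ^ card {..<s}"
      unfolding P_def using that \<psi>(1) assms(1)
      by (intro card_PiE_prescribed) (auto simp: L_def P_def)
    ultimately show ?thesis
      using that(1) \<psi>(2) by (simp add: L_def distinct_card)
  next
    case True
    show ?thesis
      by (simp only: True card.empty mult_0 le0)
  qed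
  have "{\<phi> \<in> P. \<exists>is. set is \<subseteq> {..<s} \<and> distinct is \<and> length is = r \<and> map \<phi> is \<in> T} =
      (\<Union>(is, xs)\<in>L \<times> T. ?F is xs)"
    by (auto simp: L_def)
  then have "card {\<phi> \<in> P. \<exists>is. set is \<subseteq> {..<s} \<and> distinct is \<and> length is = r \<and> map \<phi> is \<in> T} * card V ^ r
      \<le> (\<Sum>(is, xs)\<in>L \<times> T. card (?F is xs)) * card V ^ r"
    using fin by (simp add: case_prod_unfold card_UN_le)
  also have "\<dots> = (\<Sum>(is, xs)\<in>L \<times> T. card (?F is xs) * card V ^ r)"
    by (simp add: sum_distrib_right case_prod_unfold)
  also have "\<dots> \<le> (\<Sum>(is, xs)\<in>L \<times> T. card V ^ s)"
    using fiber by (intro sum_mono) auto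
  also have "\<dots> = s ^ r * card T * card V ^ s"
    by (simp add: L_def card_lists_length_eq card_cartesian_product case_prod_unfold)
  finally show ?thesis
    by (simp add: P_def)
qed

section \<open>Supersaturation\<close>

text \<open>
  The expected density: the \<open>s(s - 1)\<close> pairs of distinct indices are each mapped to an edge with the
  probability of a random pair of vertices; repeated indices contribute nothing.
\<close>

lemma sum_edges_of_samples:
  assumes "simple_graph G" and "card (verts G) = n"
  shows "(\<Sum>\<phi>\<in>{..<s} \<rightarrow>\<^sub>E verts G. 2 * real (card (edges (pullback {..<s} \<phi> G)))) * real n ^ 2 =
           real s * (real s - 1) * real n ^ s * (2 * real (card (edges G)))"
proof -
  define P where "P = {..<s} \<rightarrow>\<^sub>E verts G"
  define C where "C = real n ^ s * (2 * real (card (edges G)))"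
  have finV: "finite (verts G)"
    using assms(1) by (simp add: simple_graph_def)
  have pair: "(\<Sum>\<phi>\<in>P. of_bool ({\<phi> i, \<phi> j} \<in> edges G)) * real n ^ 2 = C - (if i = j then C else 0)"
    if "i < s" "j < s" for i j
  proof (cases "i = j")
    case True
    have "{\<phi> i, \<phi> j} \<notin> edges G" for \<phi> :: "nat \<Rightarrow> 'a"
      using edge_ends_distinct[OF assms(1), of "\<phi> i" "\<phi> j"] True by auto
    then show ?thesis
      using True by simp
  next
    case False
    then show ?thesis
      using sum_samples_two[OF _ finV, of "{..<s}" i j "\<lambda>u v. of_bool ({u, v} \<in> edges G)"] that
      by (simp add: P_def C_def assms(2) sum_adjacency[OF assms(1)])
  qed
  have "(\<Sum>\<phi>\<in>P. 2 * real (card (edges (pullback {..<s} \<phi> G)))) =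
      (\<Sum>\<phi>\<in>P. \<Sum>i<s. \<Sum>j<s. of_bool ({\<phi> i, \<phi> j} \<in> edges G))"
    by (intro sum.cong refl sum_adjacency_pullback assms(1)) simp
  also have "\<dots> = (\<Sum>i<s. \<Sum>j<s. \<Sum>\<phi>\<in>P. of_bool ({\<phi> i, \<phi> j} \<in> edges G))"
    by (subst sum.swap) (intro sum.cong refl sum.swap)
  finally have "(\<Sum>\<phi>\<in>P. 2 * real (card (edges (pullback {..<s} \<phi> G)))) * real n ^ 2 =
      (\<Sum>i<s. \<Sum>j<s. (\<Sum>\<phi>\<in>P. of_bool ({\<phi> i, \<phi> j} \<in> edges G)) * real n ^ 2)"
    by (simp add: sum_distrib_right)
  also have "\<dots> = (\<Sum>i<s. \<Sum>j<s. C - (if i = j then C else 0))"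
    by (intro sum.cong refl pair) auto
  also have "\<dots> = real s * (real s - 1) * C"
    by (simp add: sum_subtractf algebra_simps)
  finally show ?thesis
    by (simp add: P_def C_def mult_ac)
qed

lemma twice_edges_le:
  assumes "simple_graph G"
  shows "2 * real (card (edges G)) \<le> real (card (verts G)) ^ 2"
proof -
  have "(\<Sum>u\<in>verts G. \<Sum>v\<in>verts G. of_bool ({u, v} \<in> edges G)) \<le> (\<Sum>u\<in>verts G. \<Sum>v\<in>verts G. 1 :: real)"
    by (intro sum_mono) auto
  then show ?thesis
    by (simp add: sum_adjacency[OF assms] power2_eq_square)
qed

text \<open>
  The blow-up factor is \<open>m = \<lfloor>n / ((1 + \<theta>)s)\<rfloor>\<close>: the share of isolated vertices brings a mean
  of \<open>\<rho>(1 + \<theta>)\<close> down to \<open>\<rho>\<close>. One factor \<open>1 + \<theta>\<close> is lost there and, because \<open>n\<close> is large, at most another one in the rounding;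
  the density is quadratic in \<open>ms/n\<close>, hence the fourth power.
\<close>

lemma clique_free_density_le_RT:
  fixes Q :: "nat sgraph" and n r s :: nat and \<theta> \<rho> :: real
  assumes Q: "simple_graph Q" "verts Q = {..<s}" and "r \<ge> 2"
    and free: "\<not> has_monochromatic_copy (complete_graph r) Q c"
    and total: "color_total Q c \<le> \<rho> * (1 + \<theta>) * s"
    and "\<rho> \<ge> 0" and "\<theta> > 0" and "s > 0" and large: "s * (1 + \<theta>)\<^sup>2 \<le> \<theta> * n"
  shows "real n ^ 2 * real (card (edges Q)) \<le>
           (1 + \<theta>) ^ 4 * real s ^ 2 * real (RT n (complete_graph r) \<rho>)"
proof -
  define x where "x = real n / ((1 + \<theta>) * s)"
  define m where "m = nat \<lfloor>x\<rfloor>"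
  have pos: "(1 + \<theta>) * s > 0"
    using assms(7,8) by simp
  then have "x \<ge> 0"
    by (simp add: x_def)
  then have m: "real m \<le> x" "x \<le> real m + 1"
    by (simp_all add: m_def)
  have x_eq: "x * ((1 + \<theta>) * s) = n"
  proof -
    have "(1 + \<theta>) * s \<noteq> 0"
      using pos by linarith
    then show ?thesis
      unfolding x_def by (rule iffD1[OF nonzero_eq_divide_eq refl])
  qed
  have up: "real m * ((1 + \<theta>) * s) \<le> n"
    using mult_right_mono[OF m(1), of "(1 + \<theta>) * s"] pos by (simp add: x_eq)
  have "real m * color_total Q c \<le> real m * (\<rho> * (1 + \<theta>) * s)"
    using total by (intro mult_left_mono) auto
  also have "\<dots> \<le> \<rho> * n"
    using mult_left_mono[OF up \<open>\<rho> \<ge> 0\<close>] by (simp add: mult_ac)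
  finally have total': "real m * color_total Q c \<le> \<rho> * n" .
  have "real m * s * 1 \<le> real m * s * (1 + \<theta>)"
    using \<open>\<theta> > 0\<close> by (intro mult_left_mono) auto
  then have "real (m * s) \<le> real n"
    using up by (simp add: mult_ac)
  then have "m * s \<le> n"
    by (simp only: of_nat_le_iff)
  then have RT: "real m ^ 2 * real (card (edges Q)) \<le> real (RT n (complete_graph r) \<rho>)"
    using blow_up_le_RT[OF Q \<open>r \<ge> 2\<close> free _ total' \<open>\<rho> \<ge> 0\<close>]
    by (simp only: of_nat_le_iff flip: of_nat_mult of_nat_power)
  have "real n \<le> (1 + \<theta>)\<^sup>2 * s * m"
  proof -
    have "(1 + \<theta>) * n = (1 + \<theta>) * (x * ((1 + \<theta>) * s))"
      by (simp add: x_eq)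
    also have "\<dots> = (1 + \<theta>)\<^sup>2 * s * x"
      by (simp add: power2_eq_square mult_ac)
    also have "\<dots> \<le> (1 + \<theta>)\<^sup>2 * s * (m + 1)"
      using m(2) by (intro mult_left_mono) auto
    finally show ?thesis
      using large by (simp add: algebra_simps)
  qed
  then have "real n ^ 2 \<le> ((1 + \<theta>)\<^sup>2 * s * m) ^ 2"
    by (intro power_mono) auto
  then have "real n ^ 2 * real (card (edges Q)) \<le> ((1 + \<theta>)\<^sup>2 * s * m) ^ 2 * real (card (edges Q))"
    by (intro mult_right_mono) auto
  also have "\<dots> = (1 + \<theta>) ^ 4 * real s ^ 2 * (real m ^ 2 * real (card (edges Q)))"
    by (simp add: power_mult_distrib flip: power_mult)
  also have "\<dots> \<le> (1 + \<theta>) ^ 4 * real s ^ 2 * real (RT n (complete_graph r) \<rho>)"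
    using RT by (intro mult_left_mono) auto
  finally show ?thesis .
qed

text \<open>
  The mean edge density of the samples is estimated in two ways. A sample is bad if its mean number of colors is too
  large (\<open>bad1\<close>) or if it contains a monochromatic \<open>K\<^sub>r\<close> (\<open>bad2\<close>). The first summand on the right
  bounds the proportion of bad samples, which may have any density; the last term bounds the density of the others.
\<close>

lemma sampling_inequality:
  fixes G :: "'a sgraph" and n r s D :: nat and \<theta> \<rho> :: real
  assumes G: "simple_graph G" "card (verts G) = n" and "r \<ge> 2" and "\<rho> \<ge> 1"
    and mean: "mean_coloring \<rho> G c"
    and D: "\<And>v. v \<in> verts G \<Longrightarrow> card (incident_colors G c v) \<le> D"
    and "\<theta> > 0" and "s > 0" and large: "s * (1 + \<theta>)\<^sup>2 \<le> \<theta> * n"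
  shows "(1 - 1 / s) * (2 * real (card (edges G))) \<le>
           ((real D)\<^sup>2 / (\<theta>\<^sup>2 * s) + real s ^ r * real (card (\<Union>k. mono_cliques G c r k)) / real n ^ r)
             * real n ^ 2 + 2 * (1 + \<theta>) ^ 4 * real (RT n (complete_graph r) \<rho>)"
proof -
  define V where "V = verts G"
  define P where "P = {..<s} \<rightarrow>\<^sub>E V"
  define T where "T = (\<Union>k. mono_cliques G c r k)"
  define R where "R = real (RT n (complete_graph r) \<rho>)"
  define d where "d v = real (card (incident_colors G c v))" for v
  define \<mu> where "\<mu> = (\<Sum>v\<in>V. d v) / n"
  define Q where "Q \<phi> = pullback {..<s} \<phi> G" for \<phi>
  define cQ where "cQ \<phi> e = c (\<phi> ` e)" for \<phi> :: "nat \<Rightarrow> 'a" and e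
  define bad1 where "bad1 = {\<phi> \<in> P. (\<Sum>i<s. d (\<phi> i) - \<mu>) > \<theta> * s}"
  define bad2 where "bad2 = {\<phi> \<in> P. \<exists>is. set is \<subseteq> {..<s} \<and> distinct is \<and> length is = r \<and> map \<phi> is \<in> T}"
  have "n > 0"
  proof (rule ccontr)
    assume "\<not> n > 0"
    then have "real s * (1 + \<theta>)\<^sup>2 \<le> 0"
      using large by simp
    moreover have "real s * (1 + \<theta>)\<^sup>2 > 0"
      using \<open>\<theta> > 0\<close> \<open>s > 0\<close> by simp
    ultimately show False
      by linarith
  qed
  have finV: "finite V" and "V \<noteq> {}"
    using G \<open>n > 0\<close> by (auto simp: V_def simple_graph_def)
  then have finP: "finite P" and cardP: "card P = n ^ s"
    using G(2) by (auto simp: P_def V_def finite_PiE card_PiE)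
  have \<mu>: "\<mu> \<le> \<rho>" "\<mu> \<ge> 0"
    using mean G(2) by (auto simp: \<mu>_def d_def V_def mean_coloring_def intro!: divide_nonneg_nonneg sum_nonneg)
  have "\<mu> \<le> D"
  proof -
    have "(\<Sum>v\<in>V. d v) \<le> (\<Sum>v\<in>V. real D)"
      using D by (intro sum_mono) (simp add: d_def V_def)
    then show ?thesis
      using G(2) \<open>n > 0\<close> by (simp add: \<mu>_def V_def divide_le_eq mult.commute)
  qed
  have bad1: "real (card bad1) * (\<theta>\<^sup>2 * s) \<le> (real D)\<^sup>2 * real n ^ s"
  proof -
    have "(\<Sum>v\<in>V. d v - \<mu>) = 0"
      using G(2) \<open>n > 0\<close> by (simp add: sum_subtractf \<mu>_def V_def)
    moreover have "\<bar>d v - \<mu>\<bar> \<le> D" if "v \<in> V" for v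
      using \<mu>(2) \<open>\<mu> \<le> D\<close> D[of v] that by (simp add: d_def V_def abs_le_iff)
    ultimately show ?thesis
      using sample_sum_concentration[OF finV \<open>V \<noteq> {}\<close>, of "\<lambda>v. d v - \<mu>" D \<theta> s] \<open>\<theta> > 0\<close> \<open>s > 0\<close> G(2)
      by (simp add: bad1_def P_def V_def)
  qed
  have bad2: "real (card bad2) * real n ^ r \<le> real s ^ r * card T * real n ^ s"
  proof -
    have "T \<subseteq> {xs. set xs \<subseteq> V \<and> length xs = r}"
      by (auto simp: T_def V_def mono_cliques_def)
    then have "card bad2 * card V ^ r \<le> s ^ r * card T * card V ^ s"
      using samples_hitting_tuples[OF finV, of T r s] by (simp add: bad2_def P_def)
    then show ?thesis
      using G(2) unfolding V_def by (simp only: of_nat_le_iff flip: of_nat_mult of_nat_power)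
  qed
  have sample: "2 * real (card (edges (Q \<phi>))) * real n ^ 2 \<le>
      (of_bool (\<phi> \<in> bad1) + of_bool (\<phi> \<in> bad2)) * (real s ^ 2 * real n ^ 2) + 2 * (1 + \<theta>) ^ 4 * real s ^ 2 * R"
    if \<phi>: "\<phi> \<in> P" for \<phi>
  proof (cases "\<phi> \<in> bad1 \<or> \<phi> \<in> bad2")
    case True
    have "2 * real (card (edges (Q \<phi>))) \<le> real s ^ 2"
      using twice_edges_le[of "Q \<phi>"] by (simp add: Q_def simple_pullback)
    then have "2 * real (card (edges (Q \<phi>))) * real n ^ 2 \<le> real s ^ 2 * real n ^ 2"
      by (intro mult_right_mono) auto
    also have "\<dots> \<le> (of_bool (\<phi> \<in> bad1) + of_bool (\<phi> \<in> bad2)) * (real s ^ 2 * real n ^ 2)"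
      using True mult_right_mono[of 1 "of_bool (\<phi> \<in> bad1) + of_bool (\<phi> \<in> bad2)" "real s ^ 2 * real n ^ 2"]
      by auto
    moreover have "0 \<le> 2 * (1 + \<theta>) ^ 4 * real s ^ 2 * R"
      using \<open>\<theta> > 0\<close> by (simp add: R_def)
    ultimately show ?thesis
      by linarith
  next
    case False
    have simple_Q: "simple_graph (Q \<phi>)"
      by (simp add: Q_def simple_pullback)
    have "color_total (Q \<phi>) (cQ \<phi>) \<le> (\<Sum>i<s. d (\<phi> i))"
      using card_incident_colors_pullback[OF G(1), of "{..<s}" \<phi> c]
      by (auto simp: color_total_def Q_def cQ_def[abs_def] d_def intro!: sum_mono)
    also have "\<dots> \<le> \<mu> * s + \<theta> * s"
      using False \<phi> by (simp add: bad1_def sum_subtractf not_less algebra_simps)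
    also have "\<dots> \<le> \<rho> * s + (\<rho> * \<theta>) * s"
      using \<mu>(1) \<open>\<rho> \<ge> 1\<close> \<open>\<theta> > 0\<close> by (intro add_mono mult_right_mono) auto
    finally have "color_total (Q \<phi>) (cQ \<phi>) \<le> \<rho> * (1 + \<theta>) * s"
      by (simp add: algebra_simps)
    moreover have "\<not> has_monochromatic_copy (complete_graph r) (Q \<phi>) (cQ \<phi>)"
    proof
      assume "has_monochromatic_copy (complete_graph r) (Q \<phi>) (cQ \<phi>)"
      then obtain k "is" where "is": "is \<in> mono_cliques (Q \<phi>) (cQ \<phi>) r k"
        by (auto simp: has_monochromatic_clique_iff[OF simple_Q])
      have "map \<phi> is \<in> mono_cliques G c r k"
        using "is" by (intro map_mono_clique_pullback[OF G(1) \<open>r \<ge> 2\<close>]) (simp add: Q_def cQ_def[abs_def])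
      then have "map \<phi> is \<in> T"
        by (auto simp: T_def)
      moreover have "set is \<subseteq> {..<s}" "length is = r"
        using "is" by (auto simp: mono_cliques_def Q_def)
      ultimately show False
        using False \<phi> mono_clique_distinct[OF simple_Q "is"] by (auto simp: bad2_def)
    qed
    ultimately have "real n ^ 2 * real (card (edges (Q \<phi>))) \<le> (1 + \<theta>) ^ 4 * real s ^ 2 * R"
      unfolding R_def using clique_free_density_le_RT[OF simple_Q _ \<open>r \<ge> 2\<close>] assms(4,7-9)
      by (simp add: Q_def)
    then show ?thesis
      using False by (simp add: mult_ac)
  qed
  have "real s * (real s - 1) * real n ^ s * (2 * real (card (edges G))) =
      (\<Sum>\<phi>\<in>P. 2 * real (card (edges (Q \<phi>))) * real n ^ 2)"
    using sum_edges_of_samples[OF G, of s] by (simp add: P_def V_def Q_def sum_distrib_right)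
  also have "\<dots> \<le> (\<Sum>\<phi>\<in>P. (of_bool (\<phi> \<in> bad1) + of_bool (\<phi> \<in> bad2)) * (real s ^ 2 * real n ^ 2) +
      2 * (1 + \<theta>) ^ 4 * real s ^ 2 * R)"
    by (intro sum_mono sample)
  also have "\<dots> = (\<Sum>\<phi>\<in>P. of_bool (\<phi> \<in> bad1) + of_bool (\<phi> \<in> bad2)) * (real s ^ 2 * real n ^ 2) +
      real n ^ s * (2 * (1 + \<theta>) ^ 4 * real s ^ 2 * R)"
    by (simp add: sum.distrib cardP flip: sum_distrib_right)
  also have "(\<Sum>\<phi>\<in>P. of_bool (\<phi> \<in> bad1) + of_bool (\<phi> \<in> bad2) :: real) = card bad1 + card bad2"
  proof -
    have "P \<inter> bad1 = bad1" "P \<inter> bad2 = bad2"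
      by (auto simp: bad1_def bad2_def)
    then show ?thesis
      using finP by (simp add: sum.distrib Int_def)
  qed
  finally have main: "real s * (real s - 1) * real n ^ s * (2 * real (card (edges G))) \<le>
      real (card bad1 + card bad2) * (real s ^ 2 * real n ^ 2) +
      real n ^ s * (2 * (1 + \<theta>) ^ 4 * real s ^ 2 * R)"
    by simp
  define A where "A = (real D)\<^sup>2 / (\<theta>\<^sup>2 * s)"
  define B where "B = real s ^ r * real (card T) / real n ^ r"
  have "real (card bad1) \<le> A * real n ^ s"
    using bad1 \<open>\<theta> > 0\<close> \<open>s > 0\<close> by (simp add: A_def field_simps)
  moreover have "real (card bad2) \<le> B * real n ^ s"
    using bad2 \<open>n > 0\<close> by (simp add: B_def field_simps)
  ultimately have "real (card bad1 + card bad2) * (real s ^ 2 * real n ^ 2) \<le>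
      (A * real n ^ s + B * real n ^ s) * (real s ^ 2 * real n ^ 2)"
    by (intro mult_right_mono) auto
  with main have "real s * (real s - 1) * real n ^ s * (2 * real (card (edges G))) \<le>
      (A * real n ^ s + B * real n ^ s) * (real s ^ 2 * real n ^ 2) +
      real n ^ s * (2 * (1 + \<theta>) ^ 4 * real s ^ 2 * R)"
    by linarith
  also have "\<dots> = (real n ^ s * real s ^ 2) * ((A + B) * real n ^ 2 + 2 * (1 + \<theta>) ^ 4 * R)"
    by (simp add: algebra_simps)
  also have "real s * (real s - 1) * real n ^ s * (2 * real (card (edges G))) =
      (real n ^ s * real s ^ 2) * ((1 - 1 / s) * (2 * real (card (edges G))))"
  proof -
    have "real s * (real s - 1) = real s ^ 2 * (1 - 1 / s)"
      using \<open>s > 0\<close> by (simp add: field_simps power2_eq_square)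
    then show ?thesis
      by (simp only: mult_ac)
  qed
  finally have "(real n ^ s * real s ^ 2) * ((1 - 1 / s) * (2 * real (card (edges G)))) \<le>
      (real n ^ s * real s ^ 2) * ((A + B) * real n ^ 2 + 2 * (1 + \<theta>) ^ 4 * R)" .
  moreover have "real n ^ s * real s ^ 2 > 0"
    using \<open>n > 0\<close> \<open>s > 0\<close> by simp
  ultimately show ?thesis
    unfolding T_def R_def A_def B_def by (rule mult_left_le_imp_le)
qed

lemma edges_complete_graph_nonempty: "r \<ge> 2 \<Longrightarrow> edges (complete_graph r) \<noteq> {}"
  by (auto simp: complete_graph_def intro!: exI[of _ "{0, 1}"])

lemma RT_attained:
  assumes "edges H \<noteq> {}" and "\<rho> \<ge> 0"
  obtains G :: "nat sgraph" and c where "simple_graph G" and "card (verts G) = n"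
    and "mean_coloring \<rho> G c" and "\<not> has_monochromatic_copy H G c" and "card (edges G) = RT n H \<rho>"
proof -
  have "RT n H \<rho> \<in> RT_edge_counts n H \<rho>"
    unfolding RT_def using finite_RT_edge_counts RT_edge_counts_nonempty[OF assms] by (rule Max_in)
  then show ?thesis
    using that unfolding RT_edge_counts_def by auto
qed

lemma twice_RT_le:
  assumes "edges H \<noteq> {}" and "\<rho> \<ge> 0"
  shows "2 * real (RT n H \<rho>) \<le> real n ^ 2"
proof -
  obtain G :: "nat sgraph" and c where "simple_graph G" "card (verts G) = n" "card (edges G) = RT n H \<rho>"
    using RT_attained[OF assms] by metis
  then show ?thesis
    using twice_edges_le[of G] by simp
qed

text \<open>
  Isolating the vertices with more than \<open>D\<close> colors is cheap: by Markov's inequality there are at most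
  \<open>\<rho>n / D\<close> of them.
\<close>

lemma restrict_to_few_colors:
  assumes G: "simple_graph G" "card (verts G) = n" and mean: "mean_coloring \<rho> G c"
    and "\<rho> \<ge> 0" and "D > 0"
  obtains G' where "simple_graph G'" and "verts G' = verts G" and "edges G' \<subseteq> edges G"
    and "mean_coloring \<rho> G' c" and "\<And>v. v \<in> verts G \<Longrightarrow> card (incident_colors G' c v) \<le> D"
    and "real (card (edges G)) \<le> real (card (edges G')) + \<rho> / real D * real n ^ 2"
proof -
  define B where "B = {v\<in>verts G. card (incident_colors G c v) > D}"
  define G' where "G' = \<lparr>verts = verts G, edges = {e\<in>edges G. e \<inter> B = {}}\<rparr>"
  have sel: "verts G' = verts G" "edges G' = {e\<in>edges G. e \<inter> B = {}}"
    by (simp_all add: G'_def)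
  have finV: "finite (verts G)" and finB: "finite B"
    using G(1) by (auto simp: B_def simple_graph_def)
  have simple: "simple_graph G'"
    using G(1) by (auto simp: simple_graph_def sel)
  have less: "card (incident_colors G' c v) \<le> card (incident_colors G c v)" for v
    by (intro card_mono finite_incident_colors G(1)) (auto simp: incident_colors_def sel)
  have total: "color_total G c \<le> \<rho> * n"
    using mean mean_coloring_iff_color_total[OF \<open>\<rho> \<ge> 0\<close> G(1)] G(2) by simp
  have "color_total G' c \<le> color_total G c"
    unfolding color_total_def sel using less by (intro sum_mono) simp
  then have "mean_coloring \<rho> G' c"
    using total mean_coloring_iff_color_total[OF \<open>\<rho> \<ge> 0\<close> simple] G(2) by (simp add: sel)
  moreover have "card (incident_colors G' c v) \<le> D" if "v \<in> verts G" for v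
  proof (cases "v \<in> B")
    case True
    then have "incident_colors G' c v = {}"
      by (auto simp: incident_colors_def sel)
    then show ?thesis
      by simp
  next
    case False
    then show ?thesis
      using less[of v] that by (simp add: B_def)
  qed
  moreover have "real (card (edges G)) \<le> real (card (edges G')) + \<rho> / real D * real n ^ 2"
  proof -
    have "edges G \<subseteq> edges G' \<union> (\<lambda>(u, v). {u, v}) ` (B \<times> verts G)"
    proof
      fix e assume e: "e \<in> edges G"
      then obtain u v where uv: "e = {u, v}" "u \<in> verts G" "v \<in> verts G"
        using edge_obtain_ends[OF G(1) e] by metis
      show "e \<in> edges G' \<union> (\<lambda>(u, v). {u, v}) ` (B \<times> verts G)"
      proof (cases "e \<inter> B = {}")
        case False
        then have "(u \<in> B \<and> e = {u, v}) \<or> (v \<in> B \<and> e = {v, u})"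
          using uv by auto
        then show ?thesis
          using uv by force
      qed (simp add: sel e)
    qed
    then have "card (edges G) \<le> card (edges G' \<union> (\<lambda>(u, v). {u, v}) ` (B \<times> verts G))"
      using finB finV finite_edges[OF simple] by (intro card_mono) auto
    also have "\<dots> \<le> card (edges G') + card ((\<lambda>(u, v). {u, v}) ` (B \<times> verts G))"
      by (rule card_Un_le)
    also have "card ((\<lambda>(u, v). {u, v}) ` (B \<times> verts G)) \<le> card B * n"
      using card_image_le[of "B \<times> verts G" "\<lambda>(u, v). {u, v}"] finB finV G(2)
      by (simp add: card_cartesian_product)
    finally have "real (card (edges G)) \<le> real (card (edges G') + card B * n)"
      by (simp only: of_nat_le_iff)
    moreover have "real (card B) * D \<le> \<rho> * n"
    proof -
      have "real (card B) * D = (\<Sum>v\<in>B. real D)"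
        by simp
      also have "\<dots> \<le> (\<Sum>v\<in>B. real (card (incident_colors G c v)))"
        by (intro sum_mono) (simp add: B_def)
      also have "\<dots> \<le> color_total G c"
        unfolding color_total_def using finV by (intro sum_mono2) (auto simp: B_def)
      finally show ?thesis
        using total by linarith
    qed
    then have "real (card B) * n \<le> \<rho> * n / D * n"
      using \<open>D > 0\<close> by (intro mult_right_mono) (simp_all add: field_simps)
    ultimately show ?thesis
      by (simp add: power2_eq_square)
  qed
  ultimately show ?thesis
    using that[of G'] simple by (auto simp: sel)
qed

text \<open>
  The constants are chosen so that each error in \<open>sampling_inequality\<close> takes its share of \<open>\<epsilon>\<close>. Isolating vertices
  costs half of the excess edges. Of the remaining excess \<open>\<epsilon>n\<^sup>2\<close> in twice the number of edges, the
  factors \<open>1 - 1/s\<close> and \<open>(1 + \<theta>) ^ 4\<close> and the samples with too many colors use up at most a quarter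
  each, so the last quarter has to come from monochromatic cliques.
\<close>

lemma clique_supersaturation:
  fixes \<rho> \<epsilon> :: real
  assumes "r \<ge> 2" and "\<rho> \<ge> 1" and "\<epsilon> > 0"
  shows "\<exists>\<gamma>>0. \<exists>N. \<forall>(G :: 'a sgraph) c n. simple_graph G \<and> card (verts G) = n \<and> n \<ge> N \<and>
      mean_coloring \<rho> G c \<and>
      real (card (edges G)) > real (RT n (complete_graph r) \<rho>) + \<epsilon> * real n ^ 2 \<longrightarrow>
      real (card (\<Union>k. mono_cliques G c r k)) \<ge> \<gamma> * real n ^ r"
proof -
  define D where "D = nat \<lceil>2 * \<rho> / \<epsilon>\<rceil>"
  \<comment> \<open>For \<open>\<theta> \<le> 1\<close> one has \<open>(1 + \<theta>) ^ 4 \<le> 1 + 15 \<theta>\<close>, whence the 60.\<close>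
  define \<theta> where "\<theta> = min 1 (\<epsilon> / 60)"
  define s where "s = nat \<lceil>max (4 / \<epsilon>) ((real D)\<^sup>2 * 4 / (\<epsilon> * \<theta>\<^sup>2))\<rceil>"
  define N where "N = max 1 (nat \<lceil>s * (1 + \<theta>)\<^sup>2 / \<theta>\<rceil>)"
  define \<gamma> where "\<gamma> = \<epsilon> / (4 * real s ^ r)"
  have D: "real D \<ge> 2 * \<rho> / \<epsilon>"
    unfolding D_def by linarith
  have "2 * \<rho> / \<epsilon> > 0"
    using assms by simp
  then have "D > 0"
    using D by (metis not_le of_nat_0_less_iff less_le_trans)
  have D': "\<rho> / D \<le> \<epsilon> / 2"
    using D \<open>D > 0\<close> assms(3) by (simp add: field_simps)
  have \<theta>: "0 < \<theta>" "\<theta> \<le> 1" "\<theta> \<le> \<epsilon> / 60"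
    using assms(3) by (auto simp: \<theta>_def)
  have \<theta>4: "(1 + \<theta>) ^ 4 \<le> 1 + \<epsilon> / 4"
  proof -
    have "\<theta> ^ 2 \<le> \<theta>" "\<theta> ^ 3 \<le> \<theta>" "\<theta> ^ 4 \<le> \<theta>"
      using power_decreasing[of 1 2 \<theta>] power_decreasing[of 1 3 \<theta>] power_decreasing[of 1 4 \<theta>] \<theta> by auto
    moreover have "(1 + \<theta>) ^ 4 = 1 + 4 * \<theta> + 6 * \<theta> ^ 2 + 4 * \<theta> ^ 3 + \<theta> ^ 4"
      by algebra
    ultimately show ?thesis
      using \<theta>(3) by linarith
  qed
  have s: "real s \<ge> 4 / \<epsilon>" "real s \<ge> (real D)\<^sup>2 * 4 / (\<epsilon> * \<theta>\<^sup>2)"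
    unfolding s_def by linarith+
  have "4 / \<epsilon> > 0"
    using assms(3) by simp
  then have "s > 0"
    using s(1) by (metis not_le of_nat_0_less_iff less_le_trans)
  have s': "1 / s \<le> \<epsilon> / 4" "(real D)\<^sup>2 / (\<theta>\<^sup>2 * s) \<le> \<epsilon> / 4"
    using s \<open>s > 0\<close> assms(3) \<theta>(1) by (simp_all add: field_simps)
  show ?thesis
  proof (intro exI[of _ \<gamma>] exI[of _ N] conjI allI impI)
    show "\<gamma> > 0"
      using assms(3) \<open>s > 0\<close> by (simp add: \<gamma>_def)
    fix G :: "'a sgraph" and c n
    assume "simple_graph G \<and> card (verts G) = n \<and> n \<ge> N \<and> mean_coloring \<rho> G c \<and>
      real (card (edges G)) > real (RT n (complete_graph r) \<rho>) + \<epsilon> * real n ^ 2"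
    then have G: "simple_graph G" "card (verts G) = n" "n \<ge> N" "mean_coloring \<rho> G c"
      and many: "real (card (edges G)) > real (RT n (complete_graph r) \<rho>) + \<epsilon> * real n ^ 2"
      by auto
    obtain G' where G': "simple_graph G'" "verts G' = verts G" "edges G' \<subseteq> edges G"
      "mean_coloring \<rho> G' c" "\<And>v. v \<in> verts G \<Longrightarrow> card (incident_colors G' c v) \<le> D"
      "real (card (edges G)) \<le> real (card (edges G')) + \<rho> / real D * real n ^ 2"
      using restrict_to_few_colors[OF G(1,2,4) _ \<open>D > 0\<close>] assms(2) by force
    define R where "R = real (RT n (complete_graph r) \<rho>)"
    define E where "E = real (card (edges G'))"
    define T where "T = (\<Union>k. mono_cliques G c r k)"
    define T' where "T' = (\<Union>k. mono_cliques G' c r k)"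
    have "n > 0"
      using G(3) by (simp add: N_def)
    have "T \<subseteq> {xs. set xs \<subseteq> verts G \<and> length xs = r}"
      by (auto simp: T_def mono_cliques_def)
    then have "finite T"
      using G(1) finite_lists_length_eq[of "verts G" r] finite_subset by (auto simp: simple_graph_def)
    moreover have "T' \<subseteq> T"
      using G'(2,3) by (auto simp: T_def T'_def mono_cliques_def elim!: sorted_wrt_mono_rel[rotated])
    ultimately have T: "real (card T') \<le> real (card T)"
      by (simp add: card_mono)
    have "\<rho> / D * real n ^ 2 \<le> \<epsilon> / 2 * real n ^ 2"
      using D' by (intro mult_right_mono) auto
    then have E_low: "E > R + \<epsilon> / 2 * real n ^ 2"
      using many G'(6) unfolding E_def R_def by linarith
    have E_up: "2 * E \<le> real n ^ 2"
      using twice_edges_le[OF G'(1)] G(2) G'(2) by (simp add: E_def)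
    have R_up: "2 * R \<le> real n ^ 2"
      using twice_RT_le[OF edges_complete_graph_nonempty[OF assms(1)]] assms(2) by (simp add: R_def)
    have "real n \<ge> s * (1 + \<theta>)\<^sup>2 / \<theta>"
      using G(3) by (simp add: N_def)
    then have "s * (1 + \<theta>)\<^sup>2 \<le> \<theta> * n"
      using \<theta>(1) by (simp add: field_simps)
    then have "(1 - 1 / s) * (2 * E) \<le>
        ((real D)\<^sup>2 / (\<theta>\<^sup>2 * s) + real s ^ r * real (card T') / real n ^ r) * real n ^ 2 +
        2 * (1 + \<theta>) ^ 4 * R"
      unfolding E_def T'_def R_def
      using G'(2,5) G(2) by (intro sampling_inequality G'(1,4) assms(1,2) \<theta>(1) \<open>s > 0\<close>) auto
    also have "\<dots> \<le> (\<epsilon> / 4 + real s ^ r * real (card T) / real n ^ r) * real n ^ 2 + 2 * (1 + \<epsilon> / 4) * R"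
      using s'(2) T \<theta>4
      by (intro add_mono mult_right_mono mult_left_mono divide_right_mono) (auto simp: R_def)
    finally have "2 * E \<le> 1 / s * (2 * E) + \<epsilon> / 4 * real n ^ 2 +
        real s ^ r * real (card T) / real n ^ r * real n ^ 2 + 2 * R + \<epsilon> / 4 * (2 * R)"
      by (simp add: algebra_simps)
    moreover have "1 / s * (2 * E) \<le> \<epsilon> / 4 * real n ^ 2"
      using s'(1) E_up assms(3) by (intro mult_mono) (auto simp: E_def)
    moreover have "\<epsilon> / 4 * (2 * R) \<le> \<epsilon> / 4 * real n ^ 2"
      using R_up assms(3) by (intro mult_left_mono) auto
    ultimately have "\<epsilon> / 4 * real n ^ 2 \<le> real s ^ r * real (card T) / real n ^ r * real n ^ 2"
      using E_low by linarith
    then have "\<epsilon> / 4 \<le> real s ^ r * real (card T) / real n ^ r"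
      using \<open>n > 0\<close> by (simp only: mult_le_cancel_right) simp
    then show "real (card (\<Union>k. mono_cliques G c r k)) \<ge> \<gamma> * real n ^ r"
      using \<open>n > 0\<close> \<open>s > 0\<close> by (simp add: T_def \<gamma>_def field_simps)
  qed
qed

text \<open>
  Let \<open>U k\<close> be the set of vertices that meet the color \<open>k\<close>, and \<open>\<tau> k\<close> the number of cliques in color \<open>k\<close>. The sizes of
  the sets \<open>U k\<close> sum to at most \<open>\<rho>n\<close>, so some color has \<open>\<tau> k \<ge> (\<gamma>/\<rho>) n ^ (r - 1) |U k|\<close>. As its cliques lie in
  \<open>U k\<close>, also \<open>\<tau> k \<le> |U k| ^ r \<le> n ^ (r - 2) |U k|\<^sup>2\<close>. Comparing the two bounds gives \<open>|U k| \<ge> (\<gamma>/\<rho>) n\<close>, and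
  then the first one is as large as claimed.
\<close>

lemma popular_color:
  fixes \<gamma> \<rho> :: real
  assumes G: "simple_graph G" "card (verts G) = n" and "n > 0" and mean: "mean_coloring \<rho> G c"
    and "r \<ge> 2" and "\<rho> > 0" and "\<gamma> > 0"
    and many: "real (card (\<Union>k. mono_cliques G c r k)) \<ge> \<gamma> * real n ^ r"
  obtains k where "real (card (mono_cliques G c r k)) \<ge> (\<gamma> / \<rho>)\<^sup>2 * real n ^ r"
proof -
  \<comment> \<open>Writing \<open>r = q + 2\<close> avoids truncated subtraction in the exponents.\<close>
  obtain q where q: "r = q + 2"
    using \<open>r \<ge> 2\<close> by (metis add.commute le_Suc_ex)
  define K where "K = c ` edges G"
  define U where "U k = {v\<in>verts G. k \<in> incident_colors G c v}" for k
  define \<tau> where "\<tau> k = real (card (mono_cliques G c r k))" for k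
  have finV: "finite (verts G)" and finK: "finite K" and finU: "finite (U k)" for k
    using G(1) by (auto simp: K_def U_def finite_edges simple_graph_def)
  have U_le: "card (U k) \<le> n" for k
    using card_mono[OF finV, of "U k"] G(2) by (auto simp: U_def)
  have "(\<Sum>k\<in>K. card (U k)) = (\<Sum>v\<in>verts G. card (incident_colors G c v))"
    unfolding U_def
  proof (rule sum_multicount_gen[OF finK finV, rule_format])
    fix v
    have "{k\<in>K. k \<in> incident_colors G c v} = incident_colors G c v"
      by (auto simp: K_def incident_colors_def)
    then show "card {k\<in>K. k \<in> incident_colors G c v} = card (incident_colors G c v)"
      by simp
  qed
  then have "(\<Sum>k\<in>K. real (card (U k))) = color_total G c"
    unfolding color_total_def by (metis of_nat_sum)
  also have "\<dots> \<le> \<rho> * n"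
    using mean mean_coloring_iff_color_total[OF _ G(1)] G(2) \<open>\<rho> > 0\<close> by simp
  finally have sum_U: "(\<Sum>k\<in>K. real (card (U k))) \<le> \<rho> * n" .
  have vertex: "xs ! i \<in> U k \<and> k \<in> K" if xs: "xs \<in> mono_cliques G c r k" and i: "i < r" for xs k i
  proof -
    obtain j where j: "j < r" "i \<noteq> j"
      using \<open>r \<ge> 2\<close> that[of "if i = 0 then 1 else 0"] by (cases "i = 0") (auto intro: that)
    have e: "{xs ! i, xs ! j} \<in> edges G" "c {xs ! i, xs ! j} = k"
      using mono_clique_nth[OF xs i j] by auto
    then have "k \<in> incident_colors G c (xs ! i)"
      by (auto simp: incident_colors_def intro!: image_eqI[of _ c "{xs ! i, xs ! j}"])
    then show ?thesis
      using e edge_ends_in_verts[OF G(1) e(1)] by (auto simp: U_def K_def)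
  qed
  have \<tau>_le: "\<tau> k \<le> real (card (U k)) ^ r" for k
  proof -
    have "mono_cliques G c r k \<subseteq> {xs. set xs \<subseteq> U k \<and> length xs = r}"
      using vertex by (fastforce simp: mono_cliques_def in_set_conv_nth)
    then have "card (mono_cliques G c r k) \<le> card {xs. set xs \<subseteq> U k \<and> length xs = r}"
      by (intro card_mono finite_lists_length_eq finU)
    then show ?thesis
      by (simp add: card_lists_length_eq[OF finU] \<tau>_def flip: of_nat_power)
  qed
  have "(\<Union>k. mono_cliques G c r k) = (\<Union>k\<in>K. mono_cliques G c r k)"
    using vertex[of _ _ 0] \<open>r \<ge> 2\<close> by force
  then have "card (\<Union>k. mono_cliques G c r k) \<le> (\<Sum>k\<in>K. card (mono_cliques G c r k))"
    using card_UN_le[OF finK] by metis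
  then have "real (card (\<Union>k. mono_cliques G c r k)) \<le> (\<Sum>k\<in>K. \<tau> k)"
    unfolding \<tau>_def by (metis of_nat_le_iff of_nat_sum)
  then have sum_\<tau>: "\<gamma> * real n ^ r \<le> (\<Sum>k\<in>K. \<tau> k)"
    using many by linarith
  have "\<exists>k\<in>K. \<tau> k \<ge> \<gamma> / \<rho> * real n ^ (q + 1) * real (card (U k))"
  proof (rule ccontr)
    assume none: "\<not> ?thesis"
    have "\<gamma> * real n ^ r > 0"
      using \<open>\<gamma> > 0\<close> \<open>n > 0\<close> by simp
    then have "K \<noteq> {}"
      using sum_\<tau> by auto
    then have "(\<Sum>k\<in>K. \<tau> k) < (\<Sum>k\<in>K. \<gamma> / \<rho> * real n ^ (q + 1) * real (card (U k)))"
      using none finK by (intro sum_strict_mono) (auto simp: not_le)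
    also have "\<dots> = \<gamma> / \<rho> * real n ^ (q + 1) * (\<Sum>k\<in>K. real (card (U k)))"
      by (simp add: sum_distrib_left)
    also have "\<dots> \<le> \<gamma> / \<rho> * real n ^ (q + 1) * (\<rho> * n)"
      using sum_U \<open>\<gamma> > 0\<close> \<open>\<rho> > 0\<close> by (intro mult_left_mono) auto
    also have "\<dots> = \<gamma> * real n ^ r"
      using \<open>\<rho> > 0\<close> by (simp add: q)
    finally show False
      using sum_\<tau> by linarith
  qed
  then obtain k where k: "k \<in> K" "\<tau> k \<ge> \<gamma> / \<rho> * real n ^ (q + 1) * real (card (U k))"
    by blast
  have U_pos: "card (U k) > 0"
  proof -
    obtain e where e: "e \<in> edges G" "c e = k"
      using k(1) by (auto simp: K_def)
    then obtain u v where "e = {u, v}" "u \<in> verts G"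
      using edge_obtain_ends[OF G(1) e(1)] by metis
    then have "u \<in> U k"
      using e by (auto simp: U_def incident_colors_def)
    then show ?thesis
      using finU card_gt_0_iff by blast
  qed
  have "\<gamma> / \<rho> * real n ^ (q + 1) * real (card (U k)) \<le> real (card (U k)) ^ q * real (card (U k)) * real (card (U k))"
    using k(2) \<tau>_le[of k] by (simp add: q mult_ac)
  also have "\<dots> \<le> real n ^ q * real (card (U k)) * real (card (U k))"
    using U_le[of k] by (intro mult_right_mono power_mono) auto
  finally have "(\<gamma> / \<rho> * n) * (real n ^ q * real (card (U k))) \<le> real (card (U k)) * (real n ^ q * real (card (U k)))"
    by (simp add: mult_ac)
  then have U_big: "\<gamma> / \<rho> * n \<le> real (card (U k))"
    by (rule mult_right_le_imp_le) (use U_pos \<open>n > 0\<close> in simp)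
  have "(\<gamma> / \<rho>)\<^sup>2 * real n ^ r = \<gamma> / \<rho> * real n ^ (q + 1) * (\<gamma> / \<rho> * n)"
    by (simp add: q power2_eq_square)
  also have "\<dots> \<le> \<gamma> / \<rho> * real n ^ (q + 1) * real (card (U k))"
    using U_big \<open>\<gamma> > 0\<close> \<open>\<rho> > 0\<close> by (intro mult_left_mono) auto
  also note k(2)
  finally show ?thesis
    using that by (simp add: \<tau>_def)
qed

section \<open>Comparing \<open>H\<close> with the clique on \<open>\<chi>(H)\<close> vertices\<close>

lemma proper_coloring_chromatic_number:
  assumes "simple_graph H"
  obtains col where "proper_vertex_coloring H (chromatic_number H) col"
proof -
  have "finite (verts H)"
    using assms by (simp add: simple_graph_def)
  then obtain f :: "'a \<Rightarrow> nat" where f: "bij_betw f (verts H) {..<card (verts H)}"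
    using ex_bij_betw_finite_nat atLeast0LessThan by metis
  have "proper_vertex_coloring H (card (verts H)) f"
    unfolding proper_vertex_coloring_def
  proof (intro conjI ballI impI)
    fix u v assume "u \<in> verts H" "v \<in> verts H" "{u, v} \<in> edges H"
    then show "f u \<noteq> f v"
      using f edge_ends_distinct[OF assms, of u v] by (auto simp: bij_betw_def inj_on_def)
  qed (use f in \<open>auto simp: bij_betw_def\<close>)
  then have "\<exists>c. proper_vertex_coloring H (chromatic_number H) c"
    unfolding chromatic_number_def by (rule_tac LeastI[of _ "card (verts H)"]) blast
  then show ?thesis
    using that by blast
qed

lemma chromatic_number_ge_2:
  assumes "simple_graph H" and "edges H \<noteq> {}"
  shows "chromatic_number H \<ge> 2"
proof -
  obtain col where col: "proper_vertex_coloring H (chromatic_number H) col"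
    using proper_coloring_chromatic_number[OF assms(1)] .
  obtain e where "e \<in> edges H"
    using assms(2) by blast
  then obtain u v where "{u, v} \<in> edges H" "u \<in> verts H" "v \<in> verts H"
    using edge_obtain_ends[OF assms(1)] by metis
  then have "col u \<noteq> col v" "col u < chromatic_number H" "col v < chromatic_number H"
    using col by (auto simp: proper_vertex_coloring_def)
  then show ?thesis
    by linarith
qed

lemma RT_le_RT_clique:
  fixes H :: "'v sgraph" and \<rho> \<epsilon> :: real
  assumes H: "simple_graph H" "edges H \<noteq> {}" and "\<rho> \<ge> 1" and "\<epsilon> > 0"
  shows "\<exists>N. \<forall>n\<ge>N.
    real (RT n H \<rho>) \<le> real (RT n (complete_graph (chromatic_number H)) \<rho>) + \<epsilon> * real n ^ 2"
proof -
  define r where "r = chromatic_number H"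
  define t where "t = card (verts H)"
  have "r \<ge> 2"
    using chromatic_number_ge_2[OF H] by (simp add: r_def)
  obtain col where col: "proper_vertex_coloring H r col"
    using proper_coloring_chromatic_number[OF H(1)] unfolding r_def .
  have "verts H \<noteq> {}"
    using H by (auto simp: simple_graph_def)
  then have "t \<ge> 1"
    using H(1) by (simp add: t_def simple_graph_def card_gt_0_iff Suc_le_eq)
  obtain \<gamma> :: real and N1 where "\<gamma> > 0" and N1: "\<And>(G :: nat sgraph) c n. simple_graph G \<Longrightarrow>
      card (verts G) = n \<Longrightarrow> n \<ge> N1 \<Longrightarrow> mean_coloring \<rho> G c \<Longrightarrow>
      real (card (edges G)) > real (RT n (complete_graph r) \<rho>) + \<epsilon> * real n ^ 2 \<Longrightarrow>
      real (card (\<Union>k. mono_cliques G c r k)) \<ge> \<gamma> * real n ^ r"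
    using clique_supersaturation[OF \<open>r \<ge> 2\<close> \<open>\<rho> \<ge> 1\<close> \<open>\<epsilon> > 0\<close>] by metis
  have "(\<gamma> / \<rho>)\<^sup>2 > 0"
    using \<open>\<gamma> > 0\<close> \<open>\<rho> \<ge> 1\<close> by simp
  from dense_tuples_contain_box[OF this \<open>t \<ge> 1\<close>, of r] obtain N2 where
    N2: "\<And>(V :: nat set) T. finite V \<Longrightarrow> card V \<ge> N2 \<Longrightarrow> T \<subseteq> {xs. set xs \<subseteq> V \<and> length xs = r} \<Longrightarrow>
      real (card T) \<ge> (\<gamma> / \<rho>)\<^sup>2 * real (card V) ^ r \<Longrightarrow>
      \<exists>As. length As = r \<and> (\<forall>A\<in>set As. A \<subseteq> V \<and> card A = t) \<and> listset As \<subseteq> T"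
    by blast
  show ?thesis
  proof (intro exI[of _ "max 1 (max N1 N2)"] allI impI)
    fix n assume n: "n \<ge> max 1 (max N1 N2)"
    show "real (RT n H \<rho>) \<le> real (RT n (complete_graph (chromatic_number H)) \<rho>) + \<epsilon> * real n ^ 2"
    proof (rule ccontr)
      assume "\<not> ?thesis"
      then have large: "real (RT n H \<rho>) > real (RT n (complete_graph r) \<rho>) + \<epsilon> * real n ^ 2"
        by (simp add: r_def)
      obtain G :: "nat sgraph" and c where G: "simple_graph G" "card (verts G) = n"
          "mean_coloring \<rho> G c" "\<not> has_monochromatic_copy H G c" "card (edges G) = RT n H \<rho>"
        using RT_attained[OF H(2), of \<rho> n] \<open>\<rho> \<ge> 1\<close> by (metis order_trans zero_le_one)
      have "real (card (\<Union>k. mono_cliques G c r k)) \<ge> \<gamma> * real n ^ r"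
        using n large G(5) by (intro N1[OF G(1,2) _ G(3)]) auto
      moreover have "n > 0" "\<rho> > 0"
        using n \<open>\<rho> \<ge> 1\<close> by auto
      ultimately obtain k where "real (card (mono_cliques G c r k)) \<ge> (\<gamma> / \<rho>)\<^sup>2 * real n ^ r"
        using popular_color[OF G(1,2) _ G(3) \<open>r \<ge> 2\<close>, of \<gamma>] \<open>\<gamma> > 0\<close> by metis
      moreover have finV: "finite (verts G)"
        using G(1) by (simp add: simple_graph_def)
      moreover have cliques: "mono_cliques G c r k \<subseteq> {xs. set xs \<subseteq> verts G \<and> length xs = r}"
        by (auto simp: mono_cliques_def)
      ultimately obtain As where "length As = r" "\<forall>A\<in>set As. A \<subseteq> verts G \<and> card A = t"
          "listset As \<subseteq> mono_cliques G c r k"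
        using N2[OF finV, of "mono_cliques G c r k"] G(2) n cliques by auto
      then have "has_monochromatic_copy H G c"
        using monochromatic_copy_from_box[OF H(1) col \<open>verts H \<noteq> {}\<close> G(1)] by (simp add: t_def)
      with G(4) show False
        by contradiction
    qed
  qed
qed

lemma clique_number_attained:
  assumes "simple_graph H"
  obtains K where "is_clique H K" and "card K = clique_number H"
proof -
  have "{K. is_clique H K} \<subseteq> Pow (verts H)"
    by (auto simp: is_clique_def)
  then have "finite {K. is_clique H K}"
    using assms finite_subset by (auto simp: simple_graph_def)
  moreover have "{} \<in> {K. is_clique H K}"
    by (simp add: is_clique_def)
  ultimately have "clique_number H \<in> card ` {K. is_clique H K}"
    unfolding clique_number_def by (intro Max_in) auto
  then show ?thesis
    using that by auto
qed

lemma monochromatic_clique_of_copy: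
  assumes H: "simple_graph H" and G: "simple_graph G" and copy: "has_monochromatic_copy H G c"
  shows "has_monochromatic_copy (complete_graph (clique_number H)) G c"
proof -
  obtain f k where f: "inj_on f (verts H)" "f ` verts H \<subseteq> verts G"
      "\<forall>e\<in>edges H. f ` e \<in> edges G \<and> c (f ` e) = k"
    using copy unfolding has_monochromatic_copy_iff[OF H G] by (elim exE conjE) (rule that)
  obtain K where K: "is_clique H K" "card K = clique_number H"
    using clique_number_attained[OF H] .
  then have KV: "K \<subseteq> verts H" and "finite K"
    using H finite_subset by (auto simp: is_clique_def simple_graph_def)
  then obtain xs where xs: "set xs = K" "distinct xs"
    using finite_distinct_list by blast
  have "sorted_wrt (\<lambda>x y. {f x, f y} \<in> edges G \<and> c {f x, f y} = k) xs"
  proof (unfold sorted_wrt_iff_nth_less, intro allI impI)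
    fix i j assume ij: "i < j" "j < length xs"
    then have "xs ! i \<in> K" "xs ! j \<in> K" "xs ! i \<noteq> xs ! j"
      using xs by (auto simp: nth_eq_iff_index_eq)
    then have "{xs ! i, xs ! j} \<in> edges H"
      using K(1) by (simp add: is_clique_def)
    then show "{f (xs ! i), f (xs ! j)} \<in> edges G \<and> c {f (xs ! i), f (xs ! j)} = k"
      using f(3) by force
  qed
  then have "map f xs \<in> mono_cliques G c (clique_number H) k"
    using xs K(2) KV f(2) by (auto simp: mono_cliques_def sorted_wrt_map distinct_card[symmetric])
  then show ?thesis
    by (auto simp: has_monochromatic_clique_iff[OF G])
qed

lemma RT_clique_le_RT:
  assumes "simple_graph H" and "edges (complete_graph (clique_number H)) \<noteq> {}" and "\<rho> \<ge> 0"
  shows "RT n (complete_graph (clique_number H)) \<rho> \<le> RT n H \<rho>"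
proof -
  obtain G :: "nat sgraph" and c where G: "simple_graph G" "card (verts G) = n" "mean_coloring \<rho> G c"
      "\<not> has_monochromatic_copy (complete_graph (clique_number H)) G c"
      "card (edges G) = RT n (complete_graph (clique_number H)) \<rho>"
    using RT_attained[OF assms(2,3)] .
  then show ?thesis
    using card_edges_le_RT[OF G(1,3), of H] monochromatic_clique_of_copy[OF assms(1) G(1)] by metis
qed

theorem theorem1p4:
  fixes H :: "'v sgraph" and \<rho> :: real
  assumes "simple_graph H" and "edges H \<noteq> {}" and "\<rho> \<ge> 1"
  shows "(\<exists>g \<in> o(\<lambda>n::nat. real n ^ 2). \<forall>n.
            real (RT n H \<rho>) \<le> real (RT n (complete_graph (chromatic_number H)) \<rho>) + g n)
       \<and> (chromatic_number H = clique_number H \<longrightarrow>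
          (\<exists>g \<in> o(\<lambda>n::nat. real n ^ 2). \<forall>n.
            real (RT n H \<rho>) = real (RT n (complete_graph (chromatic_number H)) \<rho>) + g n))"
proof -
  \<comment> \<open>The positive part of the difference serves both claims: it is an upper bound in general, and
    equals the difference when \<open>H\<close> contains a clique on \<open>\<chi>(H)\<close> vertices.\<close>
  define excess where
    "excess n = max 0 (real (RT n H \<rho>) - real (RT n (complete_graph (chromatic_number H)) \<rho>))" for n
  have small: "excess \<in> o(\<lambda>n. real n ^ 2)"
  proof (rule landau_o.smallI)
    fix \<epsilon> :: real assume "\<epsilon> > 0"
    obtain N where N: "\<And>n. n \<ge> N \<Longrightarrow>
        real (RT n H \<rho>) \<le> real (RT n (complete_graph (chromatic_number H)) \<rho>) + \<epsilon> * real n ^ 2"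
      using RT_le_RT_clique[OF assms \<open>\<epsilon> > 0\<close>] by blast
    have "norm (excess n) \<le> \<epsilon> * norm (real n ^ 2)" if "n \<ge> N" for n
      using N[OF that] \<open>\<epsilon> > 0\<close> by (simp add: excess_def)
    then show "\<forall>\<^sub>F n in sequentially. norm (excess n) \<le> \<epsilon> * norm (real n ^ 2)"
      by (auto simp: eventually_sequentially)
  qed
  have upper: "real (RT n H \<rho>) \<le> real (RT n (complete_graph (chromatic_number H)) \<rho>) + excess n" for n
    by (simp add: excess_def)
  have equal: "real (RT n H \<rho>) = real (RT n (complete_graph (chromatic_number H)) \<rho>) + excess n"
    if "chromatic_number H = clique_number H" for n
  proof -
    have "RT n (complete_graph (chromatic_number H)) \<rho> \<le> RT n H \<rho>"
      using RT_clique_le_RT[OF assms(1), of \<rho> n] assms(3) that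
        edges_complete_graph_nonempty[OF chromatic_number_ge_2[OF assms(1,2)]] by simp
    then show ?thesis
      by (simp add: excess_def)
  qed
  show ?thesis
    using small upper equal by blast
qed

end
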